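(* Let $\ell\ge2$ be an integer. For $m\ge1$ let $G_m=K_{m,m}$ be the complete bipartite graph on two sets of $m$ vertices, and let $M_1,\dots,M_{2m}$ be i.i.d. uniform random variables on $\{1,\dots,\ell\}$, with $M_1,\dots,M_m$ assigned to the vertices of the first set and $M_{m+1},\dots,M_{2m}$ assigned to the vertices of the second set. Let $n=m^2$ be the number of edges of $G_m$, for each edge joining vertices $i$ and $j$ let $D_{i,j}=1$ if $M_i=M_j$ and $D_{i,j}=0$ otherwise, let $\Xi_n$ be the sum of the $n$ variables $D_{i,j}$ over all edges, and let $$\xi_n=\frac{\Xi_n-n\ell^{-1}}{\sqrt{n\ell^{-1}(1-\ell^{-1})}}.$$ Then $$\xi_n\ \xrightarrow{\ \mathrm{law}\ }\ \frac{\xi}{\sqrt{\ell-1}},\qquad\text{as } m\to\infty \text{ (and thus as } n\to\infty),$$ where $\xi\sim\mathrm{VG}(\ell-1,0,1,0)$.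
   Context: $\mathrm{VG}(\alpha,0,1,0)$, for $\alpha>0$, denotes the variance-gamma distribution with parameters $(\alpha,\theta,s^2,c)=(\alpha,0,1,0)$, i.e. the probability distribution on $\mathbb{R}$ with density $$f(x)=\frac{1}{\sqrt{\pi}\,\Gamma(\alpha/2)}\Big(\frac{|x|}{2}\Big)^{\frac{\alpha-1}{2}}K_{\frac{\alpha-1}{2}}(|x|),\qquad x\in\mathbb{R},$$ where $K_\nu$ is the modified Bessel function of the second kind of order $\nu$. *)

theory Defs
  imports "HOL-Probability.Probability"
begin

text \<open>
  The modified Bessel function of the second kind, by its integral representation
  for real order \<open>\<nu>\<close>. It is meaningful for \<open>x > 0\<close>; for \<open>x \<le> 0\<close> the integral diverges
  and the value is the junk value 0.
\<close>

definition bessel_K :: "real \<Rightarrow> real \<Rightarrow> real" where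
  "bessel_K \<nu> x = (LBINT t:{0..}. exp (- x * cosh t) * cosh (\<nu> * t))"

text \<open>
  The law \<open>VG(\<alpha>, 0, 1, 0)\<close>. The value of the density at the single point 0, where the
  formula may be singular, is immaterial.
\<close>

definition VG_density :: "real \<Rightarrow> real \<Rightarrow> real" where
  "VG_density \<alpha> x =
     1 / (sqrt pi * Gamma (\<alpha> / 2)) * (\<bar>x\<bar> / 2) powr ((\<alpha> - 1) / 2) * bessel_K ((\<alpha> - 1) / 2) \<bar>x\<bar>"

definition VG :: "real \<Rightarrow> real measure" where
  "VG \<alpha> = density lborel (\<lambda>x. ennreal (VG_density \<alpha> x))"

text \<open>
  The complete bipartite graph \<open>K\<^sub>m\<^sub>,\<^sub>m\<close> has vertex classes \<open>{1..m}\<close> and \<open>{m+1..2m}\<close>. An edge is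
  represented once, as the pair with its endpoint in the first class listed first.
\<close>

definition Kmm_edges :: "nat \<Rightarrow> (nat \<times> nat) set" where
  "Kmm_edges m = {1..m} \<times> {m+1..2*m}"

definition D :: "(nat \<Rightarrow> 'a \<Rightarrow> nat) \<Rightarrow> nat \<Rightarrow> nat \<Rightarrow> 'a \<Rightarrow> real" where
  "D M i j \<omega> = (if M i \<omega> = M j \<omega> then 1 else 0)"

definition Xi :: "nat \<Rightarrow> (nat \<Rightarrow> 'a \<Rightarrow> nat) \<Rightarrow> 'a \<Rightarrow> real" where
  "Xi m M \<omega> = (\<Sum>(i, j)\<in>Kmm_edges m. D M i j \<omega>)"

definition xi :: "nat \<Rightarrow> nat \<Rightarrow> (nat \<Rightarrow> 'a \<Rightarrow> nat) \<Rightarrow> 'a \<Rightarrow> real" where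
  "xi l m M \<omega> =
     (let n = real (card (Kmm_edges m)); p = 1 / real l
      in (Xi m M \<omega> - n * p) / sqrt (n * p * (1 - p)))"

lemma card_Kmm_edges: "card (Kmm_edges m) = m^2"
  by (simp add: Kmm_edges_def power2_eq_square)

end

theory Submission
  imports Defs
begin

text \<open>
  Write \<open>d\<^sub>k\<close> for the number of vertices of the first class with mark \<open>k\<close> minus its mean \<open>m / l\<close>.
  The centred number of monochromatic edges is the sum of \<open>d\<close>(mark of \<open>j\<close>) over the second class,
  so conditionally on the first class its characteristic function is an \<open>m\<close>-th power, which is
  close to a Gaussian one with variance proportional to \<open>Q = \<Sum> d\<^sub>k\<^sup>2 / m\<close>. It remains to find
  the limit of \<open>E exp (-c Q / 2)\<close>. Expressing this exponential as the characteristic function of a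
  standard Gaussian vector \<open>z\<close> at \<open>sqrt (c / m) d\<close> and averaging over the marks first again gives an
  \<open>m\<close>-th power, which converges to a Gaussian function of the centred vector \<open>z\<close>; integrating over
  \<open>z\<close> yields \<open>(1 + t\<^sup>2 / (l - 1)) powr (-(l - 1) / 2)\<close>. The variance-gamma law has this
  characteristic function (up to scaling) because the integral representation of \<open>K\<^sub>\<nu>\<close> exhibits its
  density as a Gamma mixture of centred normal densities, and the theorem follows from Levy's
  continuity theorem.
\<close>

section \<open>A central limit estimate for m-th powers of finite character averages\<close>

text \<open>The upper bound inverts the quadratic Taylor minorant of \<open>exp w\<close>, since (1
  - w + w^2/2) (1 + w + w^2/2) = 1 + w^4/4 >= 1; the lower bound is convexity.\<close>

lemma exp_minus_approx:
  fixes w :: real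
  assumes "w \<ge> 0"
  shows "\<bar>exp (- w) - (1 - w)\<bar> \<le> w\<^sup>2 / 2"
proof -
  have pos: "0 < 1 + w + w\<^sup>2 / 2"
    using assms by (simp add: add_pos_nonneg)
  have "exp (- w) \<le> 1 / (1 + w + w\<^sup>2 / 2)"
    using exp_lower_Taylor_quadratic[OF assms] pos
    by (simp add: exp_minus inverse_eq_divide frac_le)
  also have "\<dots> \<le> 1 - w + w\<^sup>2 / 2"
  proof -
    have "(1 - w + w\<^sup>2 / 2) * (1 + w + w\<^sup>2 / 2) = 1 + (w\<^sup>2 / 2)\<^sup>2"
      by (simp add: algebra_simps power2_eq_square)
    then show ?thesis
      using pos by (simp add: divide_le_eq)
  qed
  finally show ?thesis
    using exp_ge_add_one_self[of "- w"] by (simp add: abs_le_iff)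
qed

text \<open>A central limit theorem for a variable uniform on the centred values \<open>y k\<close>,
  with an explicit rate of order m^(-1/3). The bound is linear in the variance \<open>v\<close>, so
  it can later be averaged over a random \<open>v\<close> of which only the mean is controlled.
  Working with the sixth root \<open>q\<close> of \<open>m\<close> makes every power of
  \<open>m\<close> involved an integer power of \<open>q\<close>.\<close>

lemma char_avg_power_approx:
  fixes y :: "'k \<Rightarrow> real" and m :: nat
  assumes K: "finite K" "K \<noteq> {}" and y0: "(\<Sum>k\<in>K. y k) = 0" and m: "m \<ge> 1"
  defines "v \<equiv> (\<Sum>k\<in>K. (y k)\<^sup>2) / card K"
  shows "norm (((\<Sum>k\<in>K. iexp (y k / sqrt m)) / card K) ^ m - exp (- v / 2))
           \<le> 2 * sqrt (card K) * v / (root 6 m)\<^sup>2"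
proof -
  define c where "c = real (card K)"
  define q where "q = root 6 m"
  define a where "a = (\<Sum>k\<in>K. iexp (y k / sqrt m)) / c"
  define w where "w = v / (2 * m)"
  have c: "c \<ge> 1" using K by (simp add: c_def Suc_le_eq card_gt_0_iff)
  have sc: "sqrt c \<ge> 1" using c by simp
  have q6: "q ^ 6 = m" unfolding q_def by simp
  have q1: "q \<ge> 1" using m unfolding q_def by simp
  have sq: "sqrt m = q ^ 3"
    by (rule real_sqrt_unique) (use q1 q6 in \<open>simp_all add: power_mult[symmetric]\<close>)
  have v0: "v \<ge> 0" unfolding v_def by (simp add: sum_nonneg)
  have cv: "(\<Sum>k\<in>K. (y k)\<^sup>2) = c * v" using c unfolding v_def c_def by simp
  have ybd: "\<bar>y k\<bar> \<le> sqrt (c * v)" if "k \<in> K" for k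
  proof -
    have "(y k)\<^sup>2 \<le> c * v" unfolding cv[symmetric]
      by (rule member_le_sum) (use that K in auto)
    then show ?thesis by (metis real_sqrt_abs real_sqrt_le_iff)
  qed
  have na: "norm a \<le> 1"
  proof -
    have "norm (\<Sum>k\<in>K. iexp (y k / sqrt m)) \<le> (\<Sum>k\<in>K. norm (iexp (y k / sqrt m)))"
      by (rule norm_sum)
    also have "\<dots> = c" by (simp add: c_def)
    finally show ?thesis using c unfolding a_def by (simp add: norm_divide)
  qed
  have nb: "norm (complex_of_real (exp (- w))) \<le> 1"
    using v0 by (simp add: w_def)
  have pw: "complex_of_real (exp (- w)) ^ m = exp (- v / 2)"
    using m by (simp add: w_def exp_of_nat_mult[symmetric] flip: of_real_power)
  have main: "norm (a ^ m - exp (- v / 2)) \<le> m * norm (a - exp (- w))"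
    using norm_power_diff[OF na nb, of m] unfolding pw by simp
  have 1: "norm (a - (1 - w)) \<le> v * sqrt (c * v) / (6 * q ^ 9)"
  proof -
    \<comment> \<open>The Taylor polynomials average to 1 - w: the linear terms cancel by
      \<open>y0\<close>, and the quadratic ones give \<open>w\<close>.\<close>
    have "a - (1 - w) = (\<Sum>k\<in>K. iexp (y k / sqrt m) - (1 + \<i> * (y k / sqrt m) - (y k / sqrt m)\<^sup>2 / 2)) / c"
    proof -
      have "(\<Sum>k\<in>K. 1 + \<i> * (y k / sqrt m) - (y k / sqrt m)\<^sup>2 / 2)
          = c + \<i> * complex_of_real ((\<Sum>k\<in>K. y k) / sqrt m) - complex_of_real ((\<Sum>k\<in>K. (y k)\<^sup>2) / m / 2)"
        by (simp add: sum.distrib sum_subtractf c_def power_divide sum_divide_distrib sum_distrib_left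
            flip: of_real_power)
      also have "\<dots> = c * (1 - w)"
        unfolding y0 cv using c by (simp add: w_def algebra_simps)
      finally show ?thesis using c
        by (simp add: sum_subtractf a_def diff_divide_distrib del: of_real_diff)
    qed
    also have "norm \<dots> \<le> (\<Sum>k\<in>K. \<bar>y k / sqrt m\<bar> ^ 3 / 6) / c"
    proof -
      have third_order: "norm (iexp x - (1 + \<i> * x - x\<^sup>2 / 2)) \<le> \<bar>x\<bar> ^ 3 / 6" for x :: real
        using iexp_approx1[of x 2]
        by (simp add: eval_nat_numeral fact_numeral power_mult_distrib algebra_simps)
      have "norm (\<Sum>k\<in>K. iexp (y k / sqrt m) - (1 + \<i> * (y k / sqrt m) - (y k / sqrt m)\<^sup>2 / 2))
         \<le> (\<Sum>k\<in>K. \<bar>y k / sqrt m\<bar> ^ 3 / 6)"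
        by (intro order_trans[OF norm_sum] sum_mono) (rule third_order)
      then show ?thesis using c by (simp add: norm_divide divide_right_mono)
    qed
    \<comment> \<open>One of the three factors of the cube is bounded by the maximum
      \<open>sqrt (c * v)\<close>; the remaining squares then sum to \<open>c * v\<close>.\<close>
    also have "\<dots> \<le> (\<Sum>k\<in>K. (y k)\<^sup>2 * sqrt (c * v) / (6 * q ^ 9)) / c"
    proof (intro divide_right_mono sum_mono)
      fix k assume k: "k \<in> K"
      have "\<bar>y k / sqrt m\<bar> ^ 3 / 6 = (y k)\<^sup>2 * \<bar>y k\<bar> / (6 * q ^ 9)"
        unfolding sq using q1 by (simp add: power_divide abs_mult power2_eq_square power3_eq_cube power_mult[symmetric] abs_divide power_abs)
          (simp add: eval_nat_numeral abs_mult)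
      also have "\<dots> \<le> (y k)\<^sup>2 * sqrt (c * v) / (6 * q ^ 9)"
        using ybd[OF k] q1 by (intro divide_right_mono mult_left_mono) auto
      finally show "\<bar>y k / sqrt m\<bar> ^ 3 / 6 \<le> (y k)\<^sup>2 * sqrt (c * v) / (6 * q ^ 9)" .
    qed (use c in auto)
    also have "\<dots> = v * sqrt (c * v) / (6 * q ^ 9)"
      unfolding sum_divide_distrib[symmetric] sum_distrib_right[symmetric] cv using c by simp
    finally show ?thesis .
  qed
  have 2: "norm (complex_of_real (exp (- w)) - (1 - w)) \<le> v\<^sup>2 / (8 * q ^ 12)"
  proof -
    have "norm (complex_of_real (exp (- w)) - (1 - w)) = \<bar>exp (- w) - (1 - w)\<bar>"
      by (metis norm_of_real of_real_1 of_real_diff real_norm_def)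
    also have "\<dots> \<le> w\<^sup>2 / 2" by (rule exp_minus_approx) (simp add: w_def v0)
    also have "\<dots> = v\<^sup>2 / (8 * q ^ 12)"
    proof -
      have "(real m)\<^sup>2 = q ^ 12"
        unfolding q6[symmetric] using power_mult[of q 6 2] by simp
      then show ?thesis unfolding w_def by (simp add: power_divide power_mult_distrib)
    qed
    finally show ?thesis .
  qed
  have "norm (a ^ m - exp (- v / 2)) \<le> 2 * sqrt c * v / q\<^sup>2"
  \<comment> \<open>The Taylor error is of order v^(3/2) / q^3. Below the threshold, sqrt v <= q
    turns this into v / q^2. Above it, v / q^2 exceeds 1 and the trivial bound 2 on the difference
    suffices.\<close>
  proof (cases "v \<le> q\<^sup>2")
    case True
    have sv: "sqrt v \<le> q" using True q1 by (metis real_sqrt_le_iff real_sqrt_unique order_trans zero_le_one)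
    have "norm (a - exp (- w)) \<le> norm (a - (1 - w)) + norm (complex_of_real (exp (- w)) - (1 - w))"
      using norm_triangle_ineq4[of "a - (1 - w)" "complex_of_real (exp (- w)) - (1 - w)"] by simp
    also have "\<dots> \<le> v * sqrt (c * v) / (6 * q ^ 9) + v\<^sup>2 / (8 * q ^ 12)" using 1 2 by simp
    also have "\<dots> \<le> v * (sqrt c * q) / (6 * q ^ 9) + v * q\<^sup>2 / (8 * q ^ 12)"
      unfolding real_sqrt_mult power2_eq_square[of v] using sv True v0 q1 c
      by (intro add_mono divide_right_mono mult_left_mono) auto
    also have "\<dots> = (v * sqrt c / 6) / q ^ 8 + (v / 8) / q ^ 10"
      using q1 by (simp add: field_simps eval_nat_numeral)
    finally have "real m * norm (a - exp (- w)) \<le> q ^ 6 * ((v * sqrt c / 6) / q ^ 8 + (v / 8) / q ^ 10)"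
      unfolding q6[symmetric] using q1 by (intro mult_left_mono) auto
    also have "\<dots> = (v * sqrt c / 6) / q\<^sup>2 + (v / 8) / q ^ 4"
      using q1 by (simp add: field_simps eval_nat_numeral)
    also have "\<dots> \<le> (v * sqrt c) / q\<^sup>2 + (v * sqrt c) / q\<^sup>2"
    proof (intro add_mono frac_le)
      show "q\<^sup>2 \<le> q ^ 4" using q1 by (simp add: power_increasing)
      show "v / 8 \<le> v * sqrt c" using mult_left_mono[OF sc v0] v0 by linarith
    qed (use v0 q1 sc c in auto)
    finally show ?thesis using main by (simp add: algebra_simps)
  next
    case False
    have "norm (a ^ m - exp (- v / 2)) \<le> norm (a ^ m) + norm (complex_of_real (exp (- v / 2)))"
      by (rule norm_triangle_ineq4)
    also have "\<dots> \<le> 1 + 1"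
      by (intro add_mono) (use na v0 in \<open>simp_all add: norm_power power_le_one\<close>)
    also have "1 + 1 = (2 :: real)" by simp
    also have "\<dots> \<le> 2 * (sqrt c * (v / q\<^sup>2))"
      using mult_mono[OF sc, of 1 "v / q\<^sup>2"] False q1 v0 c by (simp add: le_divide_eq)
    finally show ?thesis by simp
  qed
  then show ?thesis unfolding a_def q_def c_def by simp
qed

section \<open>The variance-gamma law as a Gamma mixture of normal laws, and its characteristic
  function\<close>

lemma nn_integral_Gamma_scaled:
  fixes a b :: real
  assumes a: "a > 0" and b: "b > 0"
  shows "(\<integral>\<^sup>+u. ennreal (indicator {0<..} u * u powr (a - 1) * exp (- b * u)) \<partial>lborel) = ennreal (Gamma a / b powr a)"
proof -
  let ?f = "\<lambda>u. ennreal (indicator {0<..} u * u powr (a - 1) * exp (- b * u))"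
  have "ennreal (Gamma a) = (\<integral>\<^sup>+t. ennreal (indicator {0..} t * t powr (a - 1) / exp t) \<partial>lborel)"
    by (rule Gamma_conv_nn_integral_real[OF a])
  also have "\<dots> = b * (\<integral>\<^sup>+u. ennreal (indicator {0..} (0 + b * u) * (0 + b * u) powr (a - 1) / exp (0 + b * u)) \<partial>lborel)"
    using b by (subst nn_integral_real_affine[where c = b and t = 0]) auto
  also have "(\<integral>\<^sup>+u. ennreal (indicator {0..} (0 + b * u) * (0 + b * u) powr (a - 1) / exp (0 + b * u)) \<partial>lborel)
      = (\<integral>\<^sup>+u. ennreal (b powr (a - 1)) * ?f u \<partial>lborel)"
    using b by (intro nn_integral_cong)
      (auto simp: indicator_def powr_mult exp_minus field_simps zero_le_mult_iff simp flip: ennreal_mult' ennreal_mult)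
  also have "\<dots> = ennreal (b powr (a - 1)) * (\<integral>\<^sup>+u. ?f u \<partial>lborel)"
    by (rule nn_integral_cmult) simp
  also have "ennreal b * (ennreal (b powr (a - 1)) * (\<integral>\<^sup>+u. ?f u \<partial>lborel)) = ennreal (b powr a) * (\<integral>\<^sup>+u. ?f u \<partial>lborel)"
    using b by (simp add: powr_diff flip: mult.assoc ennreal_mult)
  finally have *: "ennreal (b powr a) * (\<integral>\<^sup>+u. ?f u \<partial>lborel) = ennreal (Gamma a)" by simp
  define I where "I = (\<integral>\<^sup>+u. ?f u \<partial>lborel)"
  have "I = (ennreal (1 / b powr a) * ennreal (b powr a)) * I"
    using b by (simp flip: ennreal_mult)
  also have "\<dots> = ennreal (1 / b powr a) * ennreal (Gamma a)"
    unfolding mult.assoc * [folded I_def] ..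
  finally show ?thesis unfolding I_def using a b by (simp add: Gamma_real_pos less_imp_le flip: ennreal_mult)
qed

text \<open>Splitting cosh (nu t) into its two exponentials and reflecting one of them by t -> -t,
  which fixes cosh t, unfolds the half line to the whole line. The integrability hypothesis permits
  the splitting.\<close>

lemma bessel_K_eq_half_line:
  assumes int: "integrable lborel (\<lambda>t. exp (- r * cosh t) * exp (\<nu> * t))"
  shows "2 * bessel_K \<nu> r = (LBINT t. exp (- r * cosh t) * exp (\<nu> * t))"
proof -
  define h where "h = (\<lambda>t. exp (- r * cosh t) * exp (\<nu> * t))"
  have h: "integrable lborel h" using int unfolding h_def .
  have h': "integrable lborel (\<lambda>t. h (- t))"
    using lborel_integrable_real_affine[OF h, of "-1" 0] by simp
  have "bessel_K \<nu> r = (LBINT t. indicator {0..} t * (h t + h (- t)) / 2)"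
    unfolding bessel_K_def set_lebesgue_integral_def h_def
    by (intro Bochner_Integration.integral_cong) (auto simp: cosh_field_def field_simps)
  also have "2 * \<dots> = (LBINT t. indicator {0..} t * h t + indicator {0..} t * h (- t))"
    by (simp add: distrib_left)
  also have "\<dots> = (LBINT t. indicator {0..} t * h t) + (LBINT t. indicator {0..} t * h (- t))"
    by (intro Bochner_Integration.integral_add)
      (use integrable_mult_indicator[OF _ h, of "{0..}"] integrable_mult_indicator[OF _ h', of "{0..}"] in simp_all)
  also have "(LBINT t. indicator {0..} t * h (- t)) = (LBINT t. indicator {..0} t * h t)"
    by (subst (2) lborel_integral_real_affine[where c = "-1" and t = 0])
      (auto intro!: Bochner_Integration.integral_cong simp: indicator_def)
  also have "(LBINT t. indicator {0..} t * h t) + (LBINT t. indicator {..0} t * h t)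
      = (LBINT t. indicator {0..} t * h t + indicator {..0} t * h t)"
    by (intro Bochner_Integration.integral_add[symmetric])
      (use integrable_mult_indicator[OF _ h, of "{0..}"] integrable_mult_indicator[OF _ h, of "{..0}"] in simp_all)
  also have "\<dots> = (LBINT t. h t)"
  \<comment> \<open>Both closed half lines contain 0, so the integrands agree only off this null
    point.\<close>
  proof (rule integral_cong_AE)
    show "AE t in lborel. indicator {0..} t * h t + indicator {..0} t * h t = h t"
      using AE_lborel_singleton[of 0] by eventually_elim (auto simp: indicator_def)
    show "h \<in> borel_measurable lborel" using h by auto
    then show "(\<lambda>t. indicator {0..} t * h t + indicator {..0} t * h t) \<in> borel_measurable lborel"
      by simp
  qed
  finally show ?thesis unfolding h_def .
qed

text \<open>The substitution \<open>u = (r / 2) e\<^sup>t\<close>.\<close>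

lemma bessel_K_mixture_integral:
  fixes r \<nu> :: real
  assumes r: "r > 0"
    and int: "set_integrable lborel {0<..} (\<lambda>u. u powr (\<nu> - 1) * exp (- u - r\<^sup>2 / (4 * u)))"
  shows "(r / 2) powr \<nu> * bessel_K \<nu> r = (LBINT u:{0<..}. u powr (\<nu> - 1) * exp (- u - r\<^sup>2 / (4 * u))) / 2"
proof -
  define f where "f = (\<lambda>t. exp (- r * cosh t) * exp (\<nu> * t))"
  define g where "g = (\<lambda>u. ln (2 * u / r))"
  define k where "k = (\<lambda>u. u powr (\<nu> - 1) * exp (- u - r\<^sup>2 / (4 * u)))"
  \<comment> \<open>\<open>g\<close> is the inverse of u = (r/2) e^t, so r cosh (g u) = u + r^2 / (4
    u), and 1 / u is the Jacobian.\<close>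
  have fg: "f (g u) / u = (2 / r) powr \<nu> * k u" if "u > 0" for u
  proof -
    have "r * cosh (g u) = u + r\<^sup>2 / (4 * u)"
      unfolding g_def using r that by (simp add: cosh_ln_real field_simps power2_eq_square)
    moreover have "exp (\<nu> * g u) = (2 / r) powr \<nu> * u powr \<nu>"
      unfolding g_def using r that by (simp add: powr_def ln_mult ln_div exp_add[symmetric] algebra_simps)
    ultimately show ?thesis unfolding f_def k_def using that by (simp add: powr_diff)
  qed
  have e0: "einterval 0 \<infinity> = {0::real<..}" by (auto simp: einterval_def)
  have kint: "set_integrable lborel (einterval 0 \<infinity>) (\<lambda>u. f (g u) * (1 / u))"
  proof -
    have "set_integrable lborel {0<..} (\<lambda>u. (2 / r) powr \<nu> * k u)"
      using int unfolding k_def by (rule set_integrable_mult_right)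
    then show ?thesis unfolding e0
      by (rule set_integrable_cong[THEN iffD1, rotated -1]) (auto simp: fg)
  qed
  have lim0: "((ereal \<circ> g \<circ> real_of_ereal) \<longlongrightarrow> - \<infinity>) (at_right 0)"
  proof -
    have "filterlim (\<lambda>u. ln (2 * u / r)) at_bot (at_right 0)"
      using r by real_asymp
    then show ?thesis
      unfolding o_def zero_ereal_def at_right_ereal g_def
      by (simp add: filterlim_filtermap tendsto_MInfty filterlim_at_bot_dense)
  qed
  have lim1: "((ereal \<circ> g \<circ> real_of_ereal) \<longlongrightarrow> \<infinity>) (at_left \<infinity>)"
  proof -
    have "filterlim (\<lambda>u. ln (2 * u / r)) at_top at_top"
      using r by real_asymp
    then show ?thesis
      unfolding o_def at_left_PInf g_def
      by (simp add: filterlim_filtermap tendsto_PInfty filterlim_at_top_dense)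
  qed
  have deriv: "DERIV g u :> 1 / u" if "u > 0" for u
    unfolding g_def using r that by (auto intro!: derivative_eq_intros)
  have contf: "isCont f t" for t
    unfolding f_def by (intro continuous_intros)
  note subst = interval_integral_substitution_nonneg[where f = f and g = g and g' = "\<lambda>u. 1 / u" and a = 0 and b = \<infinity>
      and A = "- \<infinity>" and B = \<infinity>, OF _ _ _ _ _ _ lim0 lim1 kint]
  \<comment> \<open>For nonnegative integrands the substitution rule also transports integrability;
    this supplies the hypothesis of \<open>bessel_K_eq_half_line\<close>.\<close>
  have int_f: "set_integrable lborel (einterval (- \<infinity>) \<infinity>) f"
    by (rule subst(1)) (auto simp: deriv contf f_def intro!: continuous_intros)
  have eq: "(LBINT t=-\<infinity>..\<infinity>. f t) = (LBINT u=0..\<infinity>. f (g u) * (1 / u))"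
    by (rule subst(2)) (auto simp: deriv contf f_def intro!: continuous_intros)
  have "2 * bessel_K \<nu> r = (LBINT t. f t)"
    unfolding f_def by (rule bessel_K_eq_half_line) (use int_f in \<open>simp add: f_def set_integrable_def\<close>)
  also have "\<dots> = (LBINT t=-\<infinity>..\<infinity>. f t)"
    by (simp add: interval_lebesgue_integral_def set_lebesgue_integral_def)
  also have "\<dots> = (LBINT u:{0<..}. (2 / r) powr \<nu> * k u)"
  proof -
    have "(LBINT u:{0<..}. f (g u) / u) = (LBINT u:{0<..}. (2 / r) powr \<nu> * k u)"
      by (rule set_lebesgue_integral_cong) (auto simp: fg)
    then show ?thesis unfolding eq by (simp add: interval_lebesgue_integral_def e0)
  qed
  also have "\<dots> = (2 / r) powr \<nu> * (LBINT u:{0<..}. k u)" by simp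
  finally have "(r / 2) powr \<nu> * (2 * bessel_K \<nu> r) = ((r / 2) powr \<nu> * (2 / r) powr \<nu>) * (LBINT u:{0<..}. k u)"
    by simp
  moreover have "(r / 2) powr \<nu> * (2 / r) powr \<nu> = 1"
    using r by (simp flip: powr_mult)
  ultimately show ?thesis unfolding k_def by simp
qed

text \<open>The joint density of (U, X), where U has the Gamma law of shape \<open>a\<close> and
  rate 1 and X given U = u is centred normal with variance 2u.\<close>

definition VG_mixand :: "real \<Rightarrow> real \<times> real \<Rightarrow> real" where
  "VG_mixand a = (\<lambda>(u, x). indicator {0<..} u * u powr (a - 1) * exp (- u) / Gamma a * normal_density 0 (sqrt (2 * u)) x)"

lemma VG_mixand_nonneg: "a > 0 \<Longrightarrow> VG_mixand a z \<ge> 0"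
  by (auto simp: VG_mixand_def Gamma_real_pos less_imp_le split: prod.split)

lemma VG_mixand_measurable [measurable]: "VG_mixand a \<in> borel_measurable (borel \<Otimes>\<^sub>M borel)"
  unfolding VG_mixand_def normal_density_def by measurable

lemma nn_integral_VG_mixand_snd:
  assumes "a > 0"
  shows "(\<integral>\<^sup>+x. ennreal (VG_mixand a (u, x)) \<partial>lborel) = ennreal (indicator {0<..} u * u powr (a - 1) * exp (- u) / Gamma a)"
proof (cases "u > 0")
  case True
  have "(\<integral>\<^sup>+x. ennreal (VG_mixand a (u, x)) \<partial>lborel) =
      (\<integral>\<^sup>+x. ennreal (u powr (a - 1) * exp (- u) / Gamma a) * ennreal (normal_density 0 (sqrt (2 * u)) x) \<partial>lborel)"
    using True assms by (intro nn_integral_cong) (simp add: VG_mixand_def Gamma_real_pos less_imp_le flip: ennreal_mult)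
  also have "\<dots> = ennreal (u powr (a - 1) * exp (- u) / Gamma a) * (\<integral>\<^sup>+x. ennreal (normal_density 0 (sqrt (2 * u)) x) \<partial>lborel)"
    by (rule nn_integral_cmult) simp
  also have "(\<integral>\<^sup>+x. ennreal (normal_density 0 (sqrt (2 * u)) x) \<partial>lborel) = 1"
    using True by (subst nn_integral_eq_integral) auto
  finally show ?thesis using True by simp
qed (simp add: VG_mixand_def)

text \<open>The Laplace transform of the Gamma law: c = 0 gives the total mass of the mixture, c =
  t^2 its characteristic function.\<close>

lemma nn_integral_Gamma_density_exp:
  assumes a: "a > 0" and c: "c \<ge> 0"
  shows "(\<integral>\<^sup>+u. ennreal (indicator {0<..} u * u powr (a - 1) * exp (- u) / Gamma a * exp (- c * u)) \<partial>lborel)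
     = ennreal ((1 + c) powr (- a))"
proof -
  have G: "Gamma a > 0" using a by (rule Gamma_real_pos)
  have "(\<integral>\<^sup>+u. ennreal (indicator {0<..} u * u powr (a - 1) * exp (- u) / Gamma a * exp (- c * u)) \<partial>lborel)
     = (\<integral>\<^sup>+u. ennreal (1 / Gamma a) * ennreal (indicator {0<..} u * u powr (a - 1) * exp (- (1 + c) * u)) \<partial>lborel)"
    using G by (intro nn_integral_cong) (simp add: field_simps exp_add[symmetric] flip: ennreal_mult)
  also have "\<dots> = ennreal (1 / Gamma a) * ennreal (Gamma a / (1 + c) powr a)"
    using a c by (subst nn_integral_cmult, simp, subst nn_integral_Gamma_scaled) auto
  also have "\<dots> = ennreal ((1 + c) powr (- a))"
    using G by (simp add: powr_minus field_simps flip: ennreal_mult)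
  finally show ?thesis .
qed

lemma integrable_VG_mixand:
  assumes "a > 0"
  shows "integrable (lborel \<Otimes>\<^sub>M lborel) (VG_mixand a)"
proof (rule integrableI_nonneg)
  show "VG_mixand a \<in> borel_measurable (lborel \<Otimes>\<^sub>M lborel)" by simp
  show "AE z in lborel \<Otimes>\<^sub>M lborel. 0 \<le> VG_mixand a z" using VG_mixand_nonneg[OF assms] by simp
  have "(\<integral>\<^sup>+z. ennreal (VG_mixand a z) \<partial>(lborel \<Otimes>\<^sub>M lborel)) = (\<integral>\<^sup>+u. (\<integral>\<^sup>+x. ennreal (VG_mixand a (u, x)) \<partial>lborel) \<partial>lborel)"
    by (rule lborel.nn_integral_fst[symmetric]) simp
  also have "\<dots> = 1"
    unfolding nn_integral_VG_mixand_snd[OF assms]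
    using nn_integral_Gamma_density_exp[OF assms, of 0] by simp
  finally show "(\<integral>\<^sup>+z. ennreal (VG_mixand a z) \<partial>(lborel \<Otimes>\<^sub>M lborel)) < \<infinity>" by simp
qed

text \<open>The power of u in the Gamma density is u^(nu - 1) sqrt u, and sqrt u cancels against the
  normalising constant of the normal density. What remains is the integral of
  \<open>bessel_K_mixture_integral\<close> at r = |x|, which is positive because x is
  nonzero.\<close>

lemma VG_density_mixture:
  assumes \<alpha>: "\<alpha> > 0" and x: "x \<noteq> 0" and int: "integrable lborel (\<lambda>u. VG_mixand (\<alpha> / 2) (u, x))"
  shows "VG_density \<alpha> x = (LBINT u. VG_mixand (\<alpha> / 2) (u, x))"
proof -
  define \<nu> where "\<nu> = (\<alpha> - 1) / 2"
  define C where "C = 1 / (sqrt pi * Gamma (\<alpha> / 2))"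
  have G: "Gamma (\<alpha> / 2) > 0" using \<alpha> by (simp add: Gamma_real_pos)
  have C: "C > 0" unfolding C_def using G by simp
  define k where "k = (\<lambda>u. u powr (\<nu> - 1) * exp (- u - \<bar>x\<bar>\<^sup>2 / (4 * u)))"
  have mix: "VG_mixand (\<alpha> / 2) (u, x) = C / 2 * (indicator {0<..} u * k u)" for u
  proof (cases "u > 0")
    case True
    have pw: "u powr (\<alpha> / 2 - 1) = u powr (\<nu> - 1) * sqrt u"
      using True by (simp add: \<nu>_def powr_half_sqrt[symmetric] powr_add[symmetric] field_simps)
    have nd: "normal_density 0 (sqrt (2 * u)) x = 1 / (2 * sqrt pi * sqrt u) * exp (- \<bar>x\<bar>\<^sup>2 / (4 * u))"
      using True by (simp add: normal_density_def real_sqrt_mult power_mult_distrib)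
    have ex: "exp (- u - \<bar>x\<bar>\<^sup>2 / (4 * u)) = exp (- u) * exp (- \<bar>x\<bar>\<^sup>2 / (4 * u))"
      by (simp flip: exp_add)
    have "VG_mixand (\<alpha> / 2) (u, x) = u powr (\<alpha> / 2 - 1) * exp (- u) / Gamma (\<alpha> / 2) * normal_density 0 (sqrt (2 * u)) x"
      using True by (simp add: VG_mixand_def)
    also have "\<dots> = C / 2 * (u powr (\<nu> - 1) * (exp (- u) * exp (- \<bar>x\<bar>\<^sup>2 / (4 * u))))"
      unfolding pw nd using True G by (simp add: C_def)
    finally show ?thesis using True unfolding k_def ex by simp
  qed (simp add: VG_mixand_def)
  have "set_integrable lborel {0<..} k"
    using integrable_mult_right[OF int, of "2 / C"] C unfolding mix set_integrable_def by simp
  then have "(\<bar>x\<bar> / 2) powr \<nu> * bessel_K \<nu> \<bar>x\<bar> = (LBINT u:{0<..}. k u) / 2"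
    unfolding k_def using x by (intro bessel_K_mixture_integral) auto
  then have "C * ((\<bar>x\<bar> / 2) powr \<nu> * bessel_K \<nu> \<bar>x\<bar>) = (LBINT u. C / 2 * (indicator {0<..} u * k u))"
    by (simp add: set_lebesgue_integral_def)
  then show ?thesis unfolding mix VG_density_def C_def \<nu>_def by simp
qed

lemma borel_measurable_bessel_K: "(\<lambda>x. bessel_K \<nu> \<bar>x\<bar>) \<in> borel_measurable borel"
  unfolding bessel_K_def set_lebesgue_integral_def cosh_field_def by measurable

lemma borel_measurable_VG_density [measurable]: "VG_density \<alpha> \<in> borel_measurable borel"
  using borel_measurable_bessel_K[of "(\<alpha> - 1) / 2"] unfolding VG_density_def[abs_def] by measurable

text \<open>Fubini gives integrability in \<open>u\<close> for almost every \<open>x\<close>, and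
  the excluded point 0 is null. Almost-everywhere statements suffice since the density is only ever
  integrated.\<close>

lemma
  assumes \<alpha>: "\<alpha> > 0"
  shows VG_density_nonneg_AE: "AE x in lborel. 0 \<le> VG_density \<alpha> x"
    and VG_eq_mixture: "AE x in lborel. VG_density \<alpha> x = (LBINT u. VG_mixand (\<alpha> / 2) (u, x))"
proof -
  have "integrable (lborel \<Otimes>\<^sub>M lborel) (\<lambda>(x, u). VG_mixand (\<alpha> / 2) (u, x))"
    by (rule lborel_pair.integrable_product_swap) (use \<alpha> in \<open>simp add: integrable_VG_mixand\<close>)
  from lborel_pair.AE_integrable_fst'[OF this] AE_lborel_singleton[of 0]
  show *: "AE x in lborel. VG_density \<alpha> x = (LBINT u. VG_mixand (\<alpha> / 2) (u, x))"
    by eventually_elim (use \<alpha> VG_density_mixture in auto)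
  then show "AE x in lborel. 0 \<le> VG_density \<alpha> x"
    by eventually_elim (use \<alpha> VG_mixand_nonneg in \<open>auto intro!: Bochner_Integration.integral_nonneg\<close>)
qed

lemma real_distribution_VG:
  assumes \<alpha>: "\<alpha> > 0"
  shows "real_distribution (VG \<alpha>)"
proof -
  have a: "\<alpha> / 2 > 0" using \<alpha> by simp
  have int: "integrable (lborel \<Otimes>\<^sub>M lborel) (\<lambda>(x, u). VG_mixand (\<alpha> / 2) (u, x))"
    by (rule lborel_pair.integrable_product_swap) (rule integrable_VG_mixand[OF a])
  have "emeasure (VG \<alpha>) UNIV = (\<integral>\<^sup>+x. ennreal (VG_density \<alpha> x) \<partial>lborel)"
    unfolding VG_def by (simp add: emeasure_density)
  also have "\<dots> = (\<integral>\<^sup>+x. (\<integral>\<^sup>+u. ennreal (VG_mixand (\<alpha> / 2) (u, x)) \<partial>lborel) \<partial>lborel)"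
  proof (rule nn_integral_cong_AE)
    show "AE x in lborel. ennreal (VG_density \<alpha> x) = (\<integral>\<^sup>+u. ennreal (VG_mixand (\<alpha> / 2) (u, x)) \<partial>lborel)"
      using VG_eq_mixture[OF \<alpha>] lborel_pair.AE_integrable_fst'[OF int]
      by eventually_elim (simp add: nn_integral_eq_integral VG_mixand_nonneg[OF a])
  qed
  \<comment> \<open>After the exchange the normal factor integrates to 1 in \<open>x\<close>, and
    the Gamma density is left.\<close>
  also have "\<dots> = (\<integral>\<^sup>+u. (\<integral>\<^sup>+x. ennreal (VG_mixand (\<alpha> / 2) (u, x)) \<partial>lborel) \<partial>lborel)"
    by (rule lborel_pair.Fubini') simp
  also have "\<dots> = 1"
    unfolding nn_integral_VG_mixand_snd[OF a]
    using nn_integral_Gamma_density_exp[OF a, of 0] by simp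
  finally have "prob_space (VG \<alpha>)"
    by (intro prob_spaceI) (simp add: VG_def)
  then show ?thesis
    by (simp add: real_distribution_def real_distribution_axioms_def VG_def)
qed

lemma char_normal_density:
  assumes "s > 0"
  shows "(CLBINT x. iexp (t * x) * complex_of_real (normal_density 0 s x)) = exp (- (t * s)\<^sup>2 / 2)"
proof -
  have "complex_of_real (exp (- (t * s)\<^sup>2 / 2)) = char std_normal_distribution (t * s)"
    by (simp add: char_std_normal_distribution)
  also have "\<dots> = (CLBINT x. normal_density 0 1 x *\<^sub>R iexp (t * s * x))"
    unfolding char_def by (subst integral_density) auto
  also have "\<dots> = (CLBINT x. \<bar>1 / s\<bar> *\<^sub>R (normal_density 0 1 (0 + 1 / s * x) *\<^sub>R iexp (t * s * (0 + 1 / s * x))))"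
    unfolding integral_scaleR_right using assms by (intro lborel_integral_real_affine) simp
  also have "\<dots> = (CLBINT x. iexp (t * x) * complex_of_real (normal_density 0 s x))"
    using assms by (intro Bochner_Integration.integral_cong)
      (simp_all add: normal_density_def real_sqrt_mult scaleR_conv_of_real power_divide mult_ac)
  finally show ?thesis ..
qed

text \<open>Conditionally on U = u the normal variable has characteristic function exp (-t^2 u), so
  Fubini reduces the claim to the Laplace transform of the Gamma law at t^2.\<close>

lemma char_VG:
  assumes \<alpha>: "\<alpha> > 0"
  shows "char (VG \<alpha>) t = (1 + t\<^sup>2) powr (- \<alpha> / 2)"
proof -
  define a where "a = \<alpha> / 2"
  have a: "a > 0" using \<alpha> by (simp add: a_def)
  define F where "F = (\<lambda>u x. iexp (t * x) * complex_of_real (VG_mixand a (u, x)))"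
  have intF: "integrable (lborel \<Otimes>\<^sub>M lborel) (\<lambda>(u, x). F u x)"
    by (rule Bochner_Integration.integrable_bound[OF integrable_VG_mixand[OF a]])
      (auto simp: F_def norm_mult split_beta')
  have "char (VG \<alpha>) t = (CLBINT x. VG_density \<alpha> x *\<^sub>R iexp (t * x))"
    unfolding char_def VG_def
    by (subst integral_density) (use VG_density_nonneg_AE[OF \<alpha>] in auto)
  also have "\<dots> = (CLBINT x. (CLBINT u. F u x))"
  proof (rule integral_cong_AE)
    show "AE x in lborel. VG_density \<alpha> x *\<^sub>R iexp (t * x) = (CLBINT u. F u x)"
      using VG_eq_mixture[OF \<alpha>]
      by eventually_elim (simp add: F_def a_def scaleR_conv_of_real)
  qed (auto simp: F_def)
  also have "\<dots> = (CLBINT u. (CLBINT x. F u x))"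
    by (rule lborel_pair.Fubini_integral[OF intF])
  also have "\<dots> = (CLBINT u. complex_of_real (indicator {0<..} u * u powr (a - 1) * exp (- u) / Gamma a * exp (- t\<^sup>2 * u)))"
  proof (intro Bochner_Integration.integral_cong refl)
    fix u
    show "(CLBINT x. F u x) = complex_of_real (indicator {0<..} u * u powr (a - 1) * exp (- u) / Gamma a * exp (- t\<^sup>2 * u))"
    proof (cases "u > 0")
      case True
      have "(CLBINT x. F u x) = (CLBINT x. complex_of_real (u powr (a - 1) * exp (- u) / Gamma a) *
          (iexp (t * x) * complex_of_real (normal_density 0 (sqrt (2 * u)) x)))"
        using True by (intro Bochner_Integration.integral_cong) (simp_all add: F_def VG_mixand_def)
      also have "\<dots> = complex_of_real (u powr (a - 1) * exp (- u) / Gamma a) * exp (- (t * sqrt (2 * u))\<^sup>2 / 2)"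
        unfolding integral_mult_right_zero using True by (subst char_normal_density) auto
      finally show ?thesis using True by (simp add: power_mult_distrib)
    qed (simp add: F_def VG_mixand_def)
  qed
  also have "\<dots> = complex_of_real (LBINT u. indicator {0<..} u * u powr (a - 1) * exp (- u) / Gamma a * exp (- t\<^sup>2 * u))"
    by (rule integral_complex_of_real)
  also have "(LBINT u. indicator {0<..} u * u powr (a - 1) * exp (- u) / Gamma a * exp (- t\<^sup>2 * u)) = (1 + t\<^sup>2) powr (- a)"
    using nn_integral_Gamma_density_exp[OF a, of "t\<^sup>2"] a
    by (subst integral_eq_nn_integral) (auto simp: Gamma_real_pos less_imp_le)
  finally show ?thesis by (simp add: a_def)
qed

section \<open>Exponential quadratic integrals of standard normal vectors\<close>

lemma nn_integral_std_normal_exp_quadratic: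
  fixes a b :: real
  assumes a: "1 + a > 0"
  shows "(\<integral>\<^sup>+z. ennreal (exp (- a * z\<^sup>2 / 2 + b * z)) \<partial>std_normal_distribution)
    = ennreal ((1 + a) powr (- 1 / 2) * exp (b\<^sup>2 / (2 * (1 + a))))"
proof -
  define C where "C = (1 + a) powr (- 1 / 2) * exp (b\<^sup>2 / (2 * (1 + a)))"
  have C: "C \<ge> 0" by (simp add: C_def)
  have sqrt_eq: "(1 + a) powr (- 1 / 2) = 1 / sqrt (1 + a)"
    using powr_minus_divide[of "1 + a" "1 / 2"] powr_half_sqrt[of "1 + a"] a by simp
  have dens: "std_normal_density z * exp (- a * z\<^sup>2 / 2 + b * z) = C * normal_density (b / (1 + a)) (1 / sqrt (1 + a)) z" for z
  proof -
    have "- z\<^sup>2 / 2 + (- a * z\<^sup>2 / 2 + b * z) = b\<^sup>2 / (2 * (1 + a)) - (z - b / (1 + a))\<^sup>2 * (1 + a) / 2"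
    proof -
      define u where "u = b / (1 + a)"
      have b: "b = u * (1 + a)" using a by (simp add: u_def)
      have "(u * d)\<^sup>2 / (2 * d) = u\<^sup>2 * d / 2" if "d > 0" for d :: real
        using that by (simp add: power2_eq_square)
      from this[OF a] have "b\<^sup>2 / (2 * (1 + a)) = u\<^sup>2 * (1 + a) / 2"
        unfolding b[symmetric] .
      then show ?thesis
        unfolding u_def[symmetric] by (simp add: b power2_eq_square algebra_simps add_divide_distrib diff_divide_distrib)
    qed
    then have "exp (- z\<^sup>2 / 2) * exp (- a * z\<^sup>2 / 2 + b * z) = exp (b\<^sup>2 / (2 * (1 + a))) * exp (- ((z - b / (1 + a))\<^sup>2 * (1 + a) / 2))"
      by (simp flip: exp_add)
    then show ?thesis
      using a unfolding C_def sqrt_eq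
      by (simp add: normal_density_def real_sqrt_mult real_sqrt_divide power_divide)
  qed
  have "(\<integral>\<^sup>+z. ennreal (exp (- a * z\<^sup>2 / 2 + b * z)) \<partial>std_normal_distribution)
      = (\<integral>\<^sup>+z. ennreal C * ennreal (normal_density (b / (1 + a)) (1 / sqrt (1 + a)) z) \<partial>lborel)"
    by (subst nn_integral_density) (simp_all add: dens[symmetric] C flip: ennreal_mult')
  also have "\<dots> = ennreal C"
    using a by (simp add: nn_integral_cmult nn_integral_eq_integral)
  finally show ?thesis unfolding C_def .
qed

lemma sum_centered_squares:
  fixes z :: "'k \<Rightarrow> real"
  assumes "finite K" "K \<noteq> {}"
  shows "(\<Sum>k\<in>K. (z k - (\<Sum>k\<in>K. z k) / card K)\<^sup>2) = (\<Sum>k\<in>K. (z k)\<^sup>2) - (\<Sum>k\<in>K. z k)\<^sup>2 / card K"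
proof -
  define s where "s = (\<Sum>k\<in>K. z k)"
  define c where "c = real (card K)"
  have c: "c > 0" using assms by (simp add: c_def card_gt_0_iff)
  have "(\<Sum>k\<in>K. (z k - s / c)\<^sup>2) = (\<Sum>k\<in>K. (z k)\<^sup>2 - (2 * (s / c)) * z k + (s / c)\<^sup>2)"
    by (intro sum.cong) (simp_all add: power2_diff mult_ac)
  also have "\<dots> = (\<Sum>k\<in>K. (z k)\<^sup>2) - 2 * (s / c) * s + c * (s / c)\<^sup>2"
    by (simp only: sum.distrib sum_subtractf sum_distrib_left[symmetric] sum_constant c_def s_def)
  also have "\<dots> = (\<Sum>k\<in>K. (z k)\<^sup>2) - s\<^sup>2 / c"
    using c by (simp add: field_simps power2_eq_square)
  finally show ?thesis unfolding s_def c_def .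
qed

text \<open>
  The factor \<open>exp (a S\<^sup>2 / 2c)\<close> with \<open>S\<close> the sum of the coordinates is itself a Gaussian integral
  \<open>E exp (sqrt (a / c) S W)\<close>; after exchanging the integrals the coordinates decouple.
\<close>

lemma integral_exp_centered_squares_std_normal:
  fixes a :: real
  assumes K: "finite K" "K \<noteq> {}" and a: "a \<ge> 0"
  shows "(LINT z|PiM K (\<lambda>_. std_normal_distribution). exp (- a / 2 * (\<Sum>k\<in>K. (z k - (\<Sum>k\<in>K. z k) / card K)\<^sup>2)))
    = (1 + a) powr (- (real (card K) - 1) / 2)"
proof -
  let ?N = "std_normal_distribution"
  let ?P = "PiM K (\<lambda>_. std_normal_distribution)"
  define c where "c = real (card K)"
  define r where "r = sqrt (a / c)"
  have c: "c > 0" using K by (simp add: c_def card_gt_0_iff)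
  have r2: "r\<^sup>2 = a / c" using a c by (simp add: r_def)
  interpret N: prob_space ?N by (rule prob_space_normal_density) simp
  interpret P: product_prob_space "\<lambda>_. ?N" K ..
  interpret PN: pair_sigma_finite ?P ?N ..
  have [measurable]: "(\<lambda>z. z k) \<in> ?P \<rightarrow>\<^sub>M borel" if "k \<in> K" for k
    using measurable_component_singleton[OF that, of "\<lambda>_. ?N"] by simp
  have "(\<integral>\<^sup>+z. ennreal (exp (- a / 2 * (\<Sum>k\<in>K. (z k - (\<Sum>k\<in>K. z k) / card K)\<^sup>2))) \<partial>?P)
      = (\<integral>\<^sup>+z. (\<integral>\<^sup>+w. (\<Prod>k\<in>K. ennreal (exp (- a * (z k)\<^sup>2 / 2 + (r * w) * z k))) \<partial>?N) \<partial>?P)"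
  proof (rule nn_integral_cong)
    fix z :: "'a \<Rightarrow> real"
    define S where "S = (\<Sum>k\<in>K. z k)"
    define Q where "Q = (\<Sum>k\<in>K. (z k)\<^sup>2)"
    have "(\<integral>\<^sup>+w. (\<Prod>k\<in>K. ennreal (exp (- a * (z k)\<^sup>2 / 2 + (r * w) * z k))) \<partial>?N)
        = (\<integral>\<^sup>+w. ennreal (exp (- a * Q / 2)) * ennreal (exp (- 0 * w\<^sup>2 / 2 + (r * S) * w)) \<partial>?N)"
    proof (rule nn_integral_cong)
      fix w :: real
      have "(\<Prod>k\<in>K. exp (- a * (z k)\<^sup>2 / 2 + (r * w) * z k)) = exp (\<Sum>k\<in>K. - a * (z k)\<^sup>2 / 2 + (r * w) * z k)"
        by (rule exp_sum[symmetric]) (rule K)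
      also have "(\<Sum>k\<in>K. - a * (z k)\<^sup>2 / 2 + (r * w) * z k) = - a * Q / 2 + (r * S) * w"
      proof -
        have "(\<Sum>k\<in>K. - a * (z k)\<^sup>2 / 2 + (r * w) * z k) = (\<Sum>k\<in>K. (- a / 2) * (z k)\<^sup>2 + (r * w) * z k)"
          by simp
        also have "\<dots> = (- a / 2) * Q + (r * w) * S"
          by (simp only: sum.distrib sum_distrib_left[symmetric] Q_def S_def)
        finally show ?thesis by simp
      qed
      finally have "(\<Prod>k\<in>K. ennreal (exp (- a * (z k)\<^sup>2 / 2 + (r * w) * z k))) = ennreal (exp (- a * Q / 2 + (r * S) * w))"
        by (simp only: prod_ennreal[OF exp_ge_zero])
      also have "\<dots> = ennreal (exp (- a * Q / 2)) * ennreal (exp (- 0 * w\<^sup>2 / 2 + (r * S) * w))"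
        by (simp flip: ennreal_mult exp_add)
      finally show "(\<Prod>k\<in>K. ennreal (exp (- a * (z k)\<^sup>2 / 2 + (r * w) * z k)))
          = ennreal (exp (- a * Q / 2)) * ennreal (exp (- 0 * w\<^sup>2 / 2 + (r * S) * w))" .
    qed
    also have "\<dots> = ennreal (exp (- a * Q / 2)) * ennreal (exp ((r * S)\<^sup>2 / 2))"
      by (subst nn_integral_cmult, simp, subst nn_integral_std_normal_exp_quadratic) auto
    also have "\<dots> = ennreal (exp (- a / 2 * (Q - S\<^sup>2 / c)))"
      by (simp add: power_mult_distrib r2 algebra_simps flip: ennreal_mult exp_add)
    finally show "ennreal (exp (- a / 2 * (\<Sum>k\<in>K. (z k - (\<Sum>k\<in>K. z k) / card K)\<^sup>2)))
        = (\<integral>\<^sup>+w. (\<Prod>k\<in>K. ennreal (exp (- a * (z k)\<^sup>2 / 2 + (r * w) * z k))) \<partial>?N)"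
      unfolding sum_centered_squares[OF K] Q_def S_def c_def by simp
  qed
  also have "\<dots> = (\<integral>\<^sup>+w. (\<integral>\<^sup>+z. (\<Prod>k\<in>K. ennreal (exp (- a * (z k)\<^sup>2 / 2 + (r * w) * z k))) \<partial>?P) \<partial>?N)"
  proof (rule PN.Fubini'[symmetric])
    show "(\<lambda>(z, w). \<Prod>k\<in>K. ennreal (exp (- a * (z k)\<^sup>2 / 2 + (r * w) * z k))) \<in> borel_measurable (?P \<Otimes>\<^sub>M ?N)"
      by measurable
  qed
  \<comment> \<open>For fixed \<open>w\<close> the coordinates are independent and contribute equal
    factors. As c r^2 = a, their product carries exp (a w^2 / (2 (1 + a))), which is still
    integrable against the normal density.\<close>
  also have "\<dots> = (\<integral>\<^sup>+w. ennreal ((1 + a) powr (- c / 2)) * ennreal (exp (- (- a / (1 + a)) * w\<^sup>2 / 2 + 0 * w)) \<partial>?N)"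
  proof (rule nn_integral_cong)
    fix w :: real
    have "(\<integral>\<^sup>+z. (\<Prod>k\<in>K. ennreal (exp (- a * (z k)\<^sup>2 / 2 + (r * w) * z k))) \<partial>?P)
        = (\<Prod>k\<in>K. (\<integral>\<^sup>+x. ennreal (exp (- a * x\<^sup>2 / 2 + (r * w) * x)) \<partial>?N))"
      by (rule P.product_nn_integral_prod) (use K in auto)
    also have "\<dots> = ennreal (((1 + a) powr (- 1 / 2) * exp ((r * w)\<^sup>2 / (2 * (1 + a)))) ^ card K)"
      using a by (subst nn_integral_std_normal_exp_quadratic) (auto simp: ennreal_power)
    also have "((1 + a) powr (- 1 / 2) * exp ((r * w)\<^sup>2 / (2 * (1 + a)))) ^ card K
        = (1 + a) powr (- c / 2) * exp (- (- a / (1 + a)) * w\<^sup>2 / 2 + 0 * w)"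
    proof -
      have "((1 + a) powr (- 1 / 2)) ^ card K = (1 + a) powr (- c / 2)"
        using a by (simp add: powr_powr c_def flip: powr_realpow)
      moreover have "exp ((r * w)\<^sup>2 / (2 * (1 + a))) ^ card K = exp (c * ((r * w)\<^sup>2 / (2 * (1 + a))))"
        unfolding c_def by (rule exp_of_nat_mult[symmetric])
      moreover have "c * ((r * w)\<^sup>2 / (2 * (1 + a))) = - (- a / (1 + a)) * w\<^sup>2 / 2 + 0 * w"
        unfolding power_mult_distrib r2 using c by simp
      ultimately show ?thesis by (simp add: power_mult_distrib)
    qed
    finally show "(\<integral>\<^sup>+z. (\<Prod>k\<in>K. ennreal (exp (- a * (z k)\<^sup>2 / 2 + (r * w) * z k))) \<partial>?P)
        = ennreal ((1 + a) powr (- c / 2)) * ennreal (exp (- (- a / (1 + a)) * w\<^sup>2 / 2 + 0 * w))"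
      by (simp add: ennreal_mult)
  qed
  \<comment> \<open>The integral over \<open>w\<close> returns a factor (1 + a)^(1/2): the degree of
    freedom lost by centring, which changes the exponent from -c/2 to -(c - 1)/2.\<close>
  also have "\<dots> = ennreal ((1 + a) powr (- c / 2)) * ennreal ((1 / (1 + a)) powr (- 1 / 2))"
  proof -
    have "1 + (- a / (1 + a)) = 1 / (1 + a)" using a by (simp add: field_simps)
    then show ?thesis
      using a by (subst nn_integral_cmult, simp, subst nn_integral_std_normal_exp_quadratic) simp_all
  qed
  also have "\<dots> = ennreal ((1 + a) powr (- c / 2) * (1 / (1 + a)) powr (- 1 / 2))"
    by (simp add: ennreal_mult)
  also have "(1 + a) powr (- c / 2) * (1 / (1 + a)) powr (- 1 / 2) = (1 + a) powr (- (c - 1) / 2)"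
    using a by (simp add: powr_divide powr_minus_divide diff_divide_distrib powr_diff)
  finally show ?thesis
    unfolding c_def by (intro integral_eq_nn_integral[THEN trans]) auto
qed

section \<open>Finite uniform averages over marks and the deviations of the mark counts\<close>

text \<open>For finite \<open>I\<close> and positive \<open>l\<close>, the expectation over i.i.d.
  uniform marks indexed by \<open>I\<close>. As a finite sum it frees the conditioning and
  factorisation steps from measure theory.\<close>

definition unif_mean :: "nat \<Rightarrow> 'i set \<Rightarrow> (('i \<Rightarrow> nat) \<Rightarrow> complex) \<Rightarrow> complex" where
  "unif_mean l I g = (\<Sum>x\<in>PiE I (\<lambda>_. {1..l}). g x) / of_nat l ^ card I"

text \<open>Independence of the coordinates in finite form; every m-th power below arises from
  it.\<close>

lemma unif_mean_prod:
  assumes "finite I"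
  shows "unif_mean l I (\<lambda>x. \<Prod>i\<in>I. f (x i)) = ((\<Sum>k\<in>{1..l}. f k) / of_nat l) ^ card I"
  using prod_sum_PiE[OF assms, of "\<lambda>_. {1..l}" "\<lambda>_. f"]
  by (simp add: unif_mean_def power_divide)

lemma norm_unif_mean_le:
  "norm (unif_mean l I g) \<le> (\<Sum>x\<in>PiE I (\<lambda>_. {1..l}). norm (g x)) / real l ^ card I"
  unfolding unif_mean_def by (simp add: norm_divide norm_power divide_right_mono norm_sum)

text \<open>The quantity d_k of the overview, written as a sum of centred indicators so that sums
  over marks and over vertices can be exchanged.\<close>

definition dev :: "nat \<Rightarrow> 'i set \<Rightarrow> ('i \<Rightarrow> nat) \<Rightarrow> nat \<Rightarrow> real" where
  "dev l I x k = (\<Sum>i\<in>I. of_bool (x i = k) - 1 / real l)"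

text \<open>Exchanging the sums leaves one term per vertex, so the exponential of such a pairing
  factorises over the vertices.\<close>

lemma sum_mult_dev:
  assumes "x \<in> PiE I (\<lambda>_. {1..l})"
  shows "(\<Sum>k\<in>{1..l}. z k * dev l I x k) = (\<Sum>i\<in>I. z (x i) - (\<Sum>k\<in>{1..l}. z k) / real l)"
proof -
  have "(\<Sum>k\<in>{1..l}. z k * dev l I x k) = (\<Sum>i\<in>I. \<Sum>k\<in>{1..l}. z k * (of_bool (x i = k) - 1 / real l))"
    unfolding dev_def sum_distrib_left by (rule sum.swap)
  also have "\<dots> = (\<Sum>i\<in>I. z (x i) - (\<Sum>k\<in>{1..l}. z k) / real l)"
  proof (rule sum.cong)
    fix i assume "i \<in> I"
    then have "x i \<in> {1..l}" using assms by auto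
    then have "(\<Sum>k\<in>{1..l}. z k * of_bool (x i = k)) = z (x i)"
      by (simp add: of_bool_def if_distrib[of "\<lambda>t. _ * t"] sum.delta' cong: if_cong)
    then show "(\<Sum>k\<in>{1..l}. z k * (of_bool (x i = k) - 1 / real l)) = z (x i) - (\<Sum>k\<in>{1..l}. z k) / real l"
      by (simp add: right_diff_distrib sum_subtractf sum_divide_distrib)
  qed simp
  finally show ?thesis .
qed

lemma sum_dev_eq_0:
  assumes "x \<in> PiE I (\<lambda>_. {1..l})" "l > 0"
  shows "(\<Sum>k\<in>{1..l}. dev l I x k) = 0"
  using sum_mult_dev[OF assms(1), of "\<lambda>_. 1"] assms(2) by simp

text \<open>Distinct coordinates of a uniform point are uncorrelated, so only the diagonal terms survive.\<close>

lemma sum_dev_squares_le: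
  assumes I: "finite I" and k: "k \<in> {1..l}"
  shows "(\<Sum>x\<in>PiE I (\<lambda>_. {1..l}). (dev l I x k)\<^sup>2) \<le> real (card I) * real l ^ card I"
proof -
  have l: "l > 0" using k by simp
  let ?\<Omega> = "PiE I (\<lambda>_. {1..l})"
  define h where "h = (\<lambda>n::nat. of_bool (n = k) - 1 / real l)"
  have h0: "(\<Sum>n\<in>{1..l}. h n) = 0"
    unfolding h_def using k l by (simp add: sum_subtractf of_bool_def sum.delta)
  have off: "(\<Sum>x\<in>?\<Omega>. h (x i) * h (x j)) = 0" if ij: "i \<in> I" "j \<in> I" "i \<noteq> j" for i j
  proof -
    \<comment> \<open>Padding h (x i) h (x j) with factors 1 makes it a product over all of
      \<open>I\<close>; summing over the uniform points then factorises, and the factor at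
      \<open>i\<close> is the zero sum \<open>h0\<close>.\<close>
    define f where "f = (\<lambda>i' n. if i' = i \<or> i' = j then h n else 1)"
    have "(\<Prod>i'\<in>I. f i' (x i')) = h (x i) * h (x j)" for x
    proof -
      have "(\<Prod>i'\<in>I. f i' (x i')) = (\<Prod>i'\<in>{i, j}. h (x i'))"
        using ij I by (intro prod.mono_neutral_cong_right) (auto simp: f_def)
      then show ?thesis using ij by simp
    qed
    then have "(\<Sum>x\<in>?\<Omega>. h (x i) * h (x j)) = (\<Prod>i'\<in>I. \<Sum>n\<in>{1..l}. f i' n)"
      by (subst prod_sum_PiE) (simp_all add: I)
    also have "\<dots> = 0"
      using ij I h0 by (intro prod_zero) (auto intro!: bexI[of _ i] simp: f_def)
    finally show ?thesis .
  qed
  have "(\<Sum>x\<in>?\<Omega>. (dev l I x k)\<^sup>2) = (\<Sum>x\<in>?\<Omega>. \<Sum>i\<in>I. \<Sum>j\<in>I. h (x i) * h (x j))"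
    by (simp add: dev_def h_def power2_eq_square sum_product)
  also have "\<dots> = (\<Sum>i\<in>I. \<Sum>j\<in>I. \<Sum>x\<in>?\<Omega>. h (x i) * h (x j))"
    by (subst sum.swap, rule sum.cong[OF refl], rule sum.swap)
  also have "\<dots> \<le> (\<Sum>i\<in>I. real l ^ card I)"
  proof (rule sum_mono)
    fix i assume i: "i \<in> I"
    have "(\<Sum>j\<in>I. \<Sum>x\<in>?\<Omega>. h (x i) * h (x j)) = (\<Sum>j\<in>{i}. \<Sum>x\<in>?\<Omega>. h (x i) * h (x j))"
      using i I off by (intro sum.mono_neutral_right) auto
    also have "\<dots> = (\<Sum>x\<in>?\<Omega>. (h (x i))\<^sup>2)" by (simp add: power2_eq_square)
    also have "\<dots> \<le> (\<Sum>x\<in>?\<Omega>. 1)"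
    proof (rule sum_mono)
      fix x
      have "0 \<le> 1 / real l" "1 / real l \<le> 1" using l by simp_all
      moreover have "0 \<le> (of_bool (x i = k) :: real)" "(of_bool (x i = k) :: real) \<le> 1" by simp_all
      ultimately have "\<bar>h (x i)\<bar> \<le> 1" unfolding h_def by linarith
      then show "(h (x i))\<^sup>2 \<le> 1" by (simp add: abs_square_le_1)
    qed
    also have "\<dots> = real l ^ card I" using I by (simp add: card_PiE)
    finally show "(\<Sum>j\<in>I. \<Sum>x\<in>?\<Omega>. h (x i) * h (x j)) \<le> real l ^ card I" .
  qed
  finally show ?thesis by simp
qed

section \<open>The limit of the averaged characteristic functions\<close>

text \<open>The characteristic function of a standard normal vector at \<open>u\<close>, read
  backwards: it trades the squares of \<open>u\<close> for an expression linear in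
  \<open>u\<close>.\<close>

lemma exp_sum_squares_eq_gaussian_integral:
  fixes u :: "'k \<Rightarrow> real"
  assumes K: "finite K"
  shows "complex_of_real (exp (- (\<Sum>k\<in>K. (u k)\<^sup>2) / 2))
    = (CLINT z|PiM K (\<lambda>_. std_normal_distribution). iexp (\<Sum>k\<in>K. z k * u k))"
proof -
  let ?N = "std_normal_distribution"
  interpret N: prob_space ?N by (rule prob_space_normal_density) simp
  interpret P: product_prob_space "\<lambda>_. ?N" K ..
  have "(CLINT z|PiM K (\<lambda>_. ?N). iexp (\<Sum>k\<in>K. z k * u k)) = (CLINT z|PiM K (\<lambda>_. ?N). (\<Prod>k\<in>K. iexp (u k * z k)))"
    using K by (intro Bochner_Integration.integral_cong)
      (simp_all add: sum_distrib_left exp_sum mult_ac)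
  also have "\<dots> = (\<Prod>k\<in>K. (CLINT x|?N. iexp (u k * x)))"
    by (intro P.product_integral_prod K N.integrable_const_bound[where B = 1]) auto
  also have "\<dots> = (\<Prod>k\<in>K. complex_of_real (exp (- (u k)\<^sup>2 / 2)))"
    using char_std_normal_distribution unfolding char_def by (simp add: fun_eq_iff)
  also have "\<dots> = complex_of_real (exp (\<Sum>k\<in>K. - (u k)\<^sup>2 / 2))"
    using K by (simp add: exp_sum)
  also have "(\<Sum>k\<in>K. - (u k)\<^sup>2 / 2) = - (\<Sum>k\<in>K. (u k)\<^sup>2) / 2"
    by (simp add: sum_negf sum_divide_distrib)
  finally show ?thesis ..
qed

lemma inverse_root_6_tendsto_0: "(\<lambda>m. C / (root 6 (real m))\<^sup>2) \<longlonglongrightarrow> 0"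
proof -
  have "filterlim (\<lambda>m. root 6 (real m)) at_top sequentially"
    by real_asymp
  then show ?thesis by (intro tendsto_divide_0[OF tendsto_const] filterlim_at_top_imp_at_infinity filterlim_pow_at_top) auto
qed

text \<open>
  Replacing the squares by a Gaussian integral makes the coordinates of the uniform point
  independent given the Gaussian vector \<open>z\<close>.
\<close>

lemma unif_mean_exp_dev_squares:
  fixes m :: nat
  assumes l: "l > 0" and c: "c \<ge> 0" and m: "m \<ge> 1"
  shows "unif_mean l ({1..m} :: nat set) (\<lambda>x. exp (- (c * (\<Sum>k\<in>{1..l}. (dev l {1..m} x k)\<^sup>2) / m) / 2))
    = (CLINT z|PiM {1..l} (\<lambda>_. std_normal_distribution).
        ((\<Sum>k\<in>{1..l}. iexp (sqrt c * (z k - (\<Sum>k\<in>{1..l}. z k) / l) / sqrt m)) / l) ^ m)"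
proof -
  let ?N = "std_normal_distribution"
  let ?K = "{1..l}" and ?I = "{1..m}"
  let ?\<Omega> = "PiE ?I (\<lambda>_. ?K)"
  interpret N: prob_space ?N by (rule prob_space_normal_density) simp
  interpret P: prob_space "PiM ?K (\<lambda>_. ?N)" by (intro prob_space_PiM N.prob_space_axioms)
  have [measurable]: "(\<lambda>z. z k) \<in> PiM ?K (\<lambda>_. ?N) \<rightarrow>\<^sub>M borel" if "k \<in> ?K" for k
    using measurable_component_singleton[OF that, of "\<lambda>_. ?N"] by simp
  define r where "r = sqrt c / sqrt m"
  have r2: "(r * d)\<^sup>2 = c * d\<^sup>2 / m" for d
    using c by (simp add: r_def power_mult_distrib power_divide)
  have eq: "complex_of_real (exp (- (c * (\<Sum>k\<in>?K. (dev l ?I x k)\<^sup>2) / m) / 2))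
      = (CLINT z|PiM ?K (\<lambda>_. ?N). iexp (\<Sum>k\<in>?K. z k * (r * dev l ?I x k)))" for x
    by (subst exp_sum_squares_eq_gaussian_integral[symmetric])
      (simp_all add: r2 sum_distrib_left sum_divide_distrib)
  have int: "integrable (PiM ?K (\<lambda>_. ?N)) (\<lambda>z. iexp (\<Sum>k\<in>?K. z k * (r * dev l ?I x k)))" for x
  proof (rule P.integrable_const_bound[where B = 1])
    show "(\<lambda>z. iexp (\<Sum>k\<in>?K. z k * (r * dev l ?I x k))) \<in> borel_measurable (PiM ?K (\<lambda>_. ?N))"
      by measurable
  qed (simp del: of_real_sum of_real_mult)
  have "unif_mean l ?I (\<lambda>x. exp (- (c * (\<Sum>k\<in>?K. (dev l ?I x k)\<^sup>2) / m) / 2))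
      = (CLINT z|PiM ?K (\<lambda>_. ?N). unif_mean l ?I (\<lambda>x. iexp (\<Sum>k\<in>?K. z k * (r * dev l ?I x k))))"
    unfolding unif_mean_def eq
    by (subst integral_divide_zero, subst Bochner_Integration.integral_sum) (rule int, rule refl)
  also have "\<dots> = (CLINT z|PiM ?K (\<lambda>_. ?N). ((\<Sum>k\<in>?K. iexp (sqrt c * (z k - (\<Sum>k\<in>?K. z k) / l) / sqrt m)) / l) ^ m)"
  proof (rule Bochner_Integration.integral_cong[OF refl])
    fix z :: "nat \<Rightarrow> real"
    define b where "b = (\<Sum>k\<in>?K. z k) / l"
    have "unif_mean l ?I (\<lambda>x. iexp (\<Sum>k\<in>?K. z k * (r * dev l ?I x k)))
        = unif_mean l ?I (\<lambda>x. \<Prod>i\<in>?I. iexp (r * (z (x i) - b)))"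
      unfolding unif_mean_def
    proof (intro arg_cong2[where f = "(/)"] sum.cong refl)
      fix x assume x: "x \<in> ?\<Omega>"
      have "(\<Sum>k\<in>?K. z k * (r * dev l ?I x k)) = r * (\<Sum>k\<in>?K. z k * dev l ?I x k)"
        by (simp add: sum_distrib_left mult_ac)
      also have "\<dots> = (\<Sum>i\<in>?I. r * (z (x i) - b))"
        unfolding sum_mult_dev[OF x] b_def by (simp add: sum_distrib_left)
      finally show "iexp (\<Sum>k\<in>?K. z k * (r * dev l ?I x k)) = (\<Prod>i\<in>?I. iexp (r * (z (x i) - b)))"
        by (simp only: of_real_sum sum_distrib_left exp_sum finite_atLeastAtMost)
    qed
    also have "\<dots> = ((\<Sum>k\<in>?K. iexp (r * (z k - b))) / l) ^ m"
      by (subst unif_mean_prod) simp_all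
    finally show "unif_mean l ?I (\<lambda>x. iexp (\<Sum>k\<in>?K. z k * (r * dev l ?I x k)))
        = ((\<Sum>k\<in>?K. iexp (sqrt c * (z k - (\<Sum>k\<in>?K. z k) / l) / sqrt m)) / l) ^ m"
      unfolding b_def r_def by (simp only: times_divide_eq_left times_divide_eq_right)
  qed
  finally show ?thesis .
qed

text \<open>For fixed \<open>z\<close> the m-th power converges by
  \<open>char_avg_power_approx\<close>. All integrands have norm at most 1, so dominated convergence
  applies, and the limit integral is that of \<open>integral_exp_centered_squares_std_normal\<close>
  at a = c / l.\<close>

lemma unif_mean_exp_dev_squares_tendsto:
  assumes l: "l > 0" and c: "c \<ge> 0"
  shows "(\<lambda>m::nat. unif_mean l ({1..m} :: nat set) (\<lambda>x. exp (- (c * (\<Sum>k\<in>{1..l}. (dev l {1..m} x k)\<^sup>2) / m) / 2)))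
    \<longlonglongrightarrow> complex_of_real ((1 + c / l) powr (- (real l - 1) / 2))"
proof -
  let ?N = "std_normal_distribution"
  let ?K = "{1..l}"
  let ?P = "PiM ?K (\<lambda>_. ?N)"
  interpret N: prob_space ?N by (rule prob_space_normal_density) simp
  interpret P: prob_space ?P by (intro prob_space_PiM N.prob_space_axioms)
  have [measurable]: "(\<lambda>z. z k) \<in> ?P \<rightarrow>\<^sub>M borel" if "k \<in> ?K" for k
    using measurable_component_singleton[OF that, of "\<lambda>_. ?N"] by simp
  define b where "b = (\<lambda>z. (\<Sum>k\<in>?K. z k) / l)"
  have [measurable]: "b \<in> borel_measurable ?P" unfolding b_def by measurable
  define f where "f = (\<lambda>m z. ((\<Sum>k\<in>?K. iexp (sqrt c * (z k - b z) / sqrt (real m))) / complex_of_nat l) ^ m)"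
  define g where "g = (\<lambda>z. exp (- (c / l) / 2 * (\<Sum>k\<in>?K. (z k - b z)\<^sup>2)))"
  have "(\<lambda>m. CLINT z|?P. f m z) \<longlonglongrightarrow> (CLINT z|?P. complex_of_real (g z))"
  proof (rule integral_dominated_convergence[where w = "\<lambda>_. 1"])
    show "(\<lambda>z. complex_of_real (g z)) \<in> borel_measurable ?P" unfolding g_def by measurable
    show "f m \<in> borel_measurable ?P" for m unfolding f_def by measurable
    show "integrable ?P (\<lambda>_. 1 :: real)" by (rule P.integrable_const)
    show "AE z in ?P. norm (f m z) \<le> 1" for m
    proof (rule AE_I2)
      fix z
      have "norm (\<Sum>k\<in>?K. iexp (sqrt c * (z k - b z) / sqrt (real m))) \<le> (\<Sum>k\<in>?K. norm (iexp (sqrt c * (z k - b z) / sqrt (real m))))"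
        by (rule norm_sum)
      also have "\<dots> = l" by simp
      finally show "norm (f m z) \<le> 1"
        unfolding f_def norm_power norm_divide using l by (intro power_le_one) (auto simp: divide_le_eq)
    qed
    show "AE z in ?P. (\<lambda>m. f m z) \<longlonglongrightarrow> complex_of_real (g z)"
    proof (rule AE_I2)
      fix z
      define y where "y = (\<lambda>k. sqrt c * (z k - b z))"
      define v where "v = (\<Sum>k\<in>?K. (y k)\<^sup>2) / card ?K"
      have y0: "(\<Sum>k\<in>?K. y k) = 0"
        unfolding y_def sum_distrib_left[symmetric] b_def using l by (simp add: sum_subtractf)
      have gv: "g z = exp (- v / 2)"
        unfolding g_def v_def y_def using c by (simp add: power_mult_distrib sum_distrib_left sum_divide_distrib sum_negf)
      have "(\<lambda>m. f m z - complex_of_real (g z)) \<longlonglongrightarrow> 0"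
      proof (rule Lim_null_comparison)
        show "(\<lambda>m. 2 * sqrt (card ?K) * v / (root 6 (real m))\<^sup>2) \<longlonglongrightarrow> 0"
          by (rule inverse_root_6_tendsto_0)
        show "\<forall>\<^sub>F m in sequentially. norm (f m z - complex_of_real (g z)) \<le> 2 * sqrt (card ?K) * v / (root 6 (real m))\<^sup>2"
          using eventually_ge_at_top[of 1]
        proof eventually_elim
          case (elim m)
          show ?case
            using char_avg_power_approx[OF _ _ y0 elim] l
            unfolding gv v_def f_def y_def by (simp add: Suc_le_eq)
        qed
      qed
      then show "(\<lambda>m. f m z) \<longlonglongrightarrow> complex_of_real (g z)" by (rule LIM_zero_cancel)
    qed
  qed
  also have "(CLINT z|?P. complex_of_real (g z)) = complex_of_real (LINT z|?P. g z)"
    by (rule integral_complex_of_real)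
  also have "(LINT z|?P. g z) = (1 + c / l) powr (- (real l - 1) / 2)"
    using integral_exp_centered_squares_std_normal[of ?K "c / l"] c l
    unfolding g_def b_def by simp
  finally have lim: "(\<lambda>m. CLINT z|?P. f m z) \<longlonglongrightarrow> complex_of_real ((1 + c / l) powr (- (real l - 1) / 2))" .
  show ?thesis
  proof (rule Lim_transform_eventually[OF lim])
    show "\<forall>\<^sub>F m in sequentially. (CLINT z|?P. f m z) =
        unif_mean l {1..m} (\<lambda>x. exp (- (c * (\<Sum>k\<in>{1..l}. (dev l {1..m} x k)\<^sup>2) / m) / 2))"
      using eventually_ge_at_top[of 1]
      by eventually_elim (simp only: unif_mean_exp_dev_squares[OF l c] f_def b_def)
  qed
qed

text \<open>For each \<open>x\<close> the m-th power is close to a Gaussian function of the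
  deviations, with an error linear in \<open>Q\<close>. By \<open>sum_dev_squares_le\<close> the
  mean of \<open>Q\<close> is at most l m, so the averaged error vanishes. The previous limit with c
  = s^2 / l then applies.\<close>

lemma unif_mean_char_tendsto:
  assumes l: "l > 0"
  shows "(\<lambda>m::nat. unif_mean l ({1..m} :: nat set) (\<lambda>x. ((\<Sum>k\<in>{1..l}. iexp (s * dev l {1..m} x k / sqrt m / sqrt m)) / l) ^ m))
    \<longlonglongrightarrow> complex_of_real ((1 + s\<^sup>2 / (real l)\<^sup>2) powr (- (real l - 1) / 2))"
proof -
  let ?K = "{1..l}"
  define f where "f = (\<lambda>(m::nat) x. ((\<Sum>k\<in>?K. iexp (s * dev l {1..m} x k / sqrt m / sqrt m)) / complex_of_nat l) ^ m)"
  define Q where "Q = (\<lambda>(m::nat) x. (\<Sum>k\<in>?K. (dev l {1..m} x k)\<^sup>2))"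
  define g where "g = (\<lambda>(m::nat) x. complex_of_real (exp (- (s\<^sup>2 / l * Q m x / m) / 2)))"
  have bound: "norm (unif_mean l {1..m} (f m) - unif_mean l {1..m} (g m)) \<le> 2 * sqrt l * s\<^sup>2 / (root 6 m)\<^sup>2" if m: "m \<ge> 1" for m
  proof -
    let ?\<Omega> = "PiE {1..m} (\<lambda>_. ?K)"
    define C where "C = 2 * sqrt l * s\<^sup>2 / (root 6 m)\<^sup>2"
    have C: "C \<ge> 0" by (simp add: C_def)
    have pt: "norm (f m x - g m x) \<le> C / (real m * l) * Q m x" if x: "x \<in> ?\<Omega>" for x
    proof -
      \<comment> \<open>One factor sqrt m normalises the deviation; the other is the scaling in
        \<open>char_avg_power_approx\<close>.\<close>
      define y where "y = (\<lambda>k. s * dev l {1..m} x k / sqrt m)"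
      have y0: "(\<Sum>k\<in>?K. y k) = 0"
        unfolding y_def sum_distrib_left[symmetric] sum_divide_distrib[symmetric] sum_dev_eq_0[OF x l] by simp
      have v: "(\<Sum>k\<in>?K. (y k)\<^sup>2) / card ?K = s\<^sup>2 / l * Q m x / m"
        unfolding y_def Q_def by (simp add: power_mult_distrib power_divide sum_distrib_left sum_divide_distrib mult.commute[of "real m"])
      have "norm (f m x - g m x) \<le> 2 * sqrt (card ?K) * (s\<^sup>2 / l * Q m x / m) / (root 6 m)\<^sup>2"
        using char_avg_power_approx[OF _ _ y0 m] l
        unfolding f_def g_def y_def[symmetric] v[symmetric] by (simp add: Suc_le_eq y_def)
      then show ?thesis by (simp add: C_def mult_ac)
    qed
    have "norm (unif_mean l {1..m} (f m) - unif_mean l {1..m} (g m)) = norm (unif_mean l {1..m} (\<lambda>x. f m x - g m x))"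
      by (simp add: unif_mean_def sum_subtractf diff_divide_distrib)
    also have "\<dots> \<le> (\<Sum>x\<in>?\<Omega>. norm (f m x - g m x)) / real l ^ m"
      using norm_unif_mean_le[of l "{1..m}"] by simp
    also have "\<dots> \<le> (\<Sum>x\<in>?\<Omega>. C / (real m * l) * Q m x) / real l ^ m"
      by (intro divide_right_mono sum_mono pt) auto
    also have "(\<Sum>x\<in>?\<Omega>. C / (real m * l) * Q m x) = C / (real m * l) * (\<Sum>k\<in>?K. \<Sum>x\<in>?\<Omega>. (dev l {1..m} x k)\<^sup>2)"
      unfolding Q_def sum_distrib_left[symmetric] by (subst sum.swap) simp
    also have "\<dots> \<le> C / (real m * l) * (\<Sum>k\<in>?K. real m * real l ^ m)"
      using sum_dev_squares_le[of "{1..m}" _ l] C by (intro mult_left_mono sum_mono) auto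
    also have "\<dots> / real l ^ m = C" using m l by simp
    finally show ?thesis unfolding C_def by (simp add: divide_right_mono)
  qed
  have "(\<lambda>m. unif_mean l {1..m} (f m) - unif_mean l {1..m} (g m)) \<longlonglongrightarrow> 0"
  proof (rule Lim_null_comparison)
    show "(\<lambda>m. 2 * sqrt l * s\<^sup>2 / (root 6 (real m))\<^sup>2) \<longlonglongrightarrow> 0"
      by (rule inverse_root_6_tendsto_0)
    show "\<forall>\<^sub>F m in sequentially. norm (unif_mean l {1..m} (f m) - unif_mean l {1..m} (g m)) \<le> 2 * sqrt l * s\<^sup>2 / (root 6 (real m))\<^sup>2"
      using eventually_ge_at_top[of 1] by eventually_elim (rule bound)
  qed
  moreover have "(\<lambda>m. unif_mean l {1..m} (g m)) \<longlonglongrightarrow> complex_of_real ((1 + s\<^sup>2 / (real l)\<^sup>2) powr (- (real l - 1) / 2))"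
    using unif_mean_exp_dev_squares_tendsto[OF l, of "s\<^sup>2 / l"]
    unfolding g_def Q_def by (simp add: power2_eq_square[of "real l"])
  ultimately have "(\<lambda>m. (unif_mean l {1..m} (f m) - unif_mean l {1..m} (g m)) + unif_mean l {1..m} (g m))
      \<longlonglongrightarrow> 0 + complex_of_real ((1 + s\<^sup>2 / (real l)\<^sup>2) powr (- (real l - 1) / 2))"
    by (rule tendsto_add)
  then show ?thesis unfolding f_def by simp
qed

section \<open>From the probability space to finite averages\<close>

text \<open>Fubini for finite averages; it expresses conditioning on the marks of the first vertex
  class.\<close>

lemma unif_mean_merge:
  assumes I: "finite I" and J: "finite J" and IJ: "I \<inter> J = {}"
  shows "unif_mean l (I \<union> J) g = unif_mean l I (\<lambda>x. unif_mean l J (\<lambda>y. g (merge I J (x, y))))"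
proof -
  let ?\<Omega> = "\<lambda>I. PiE I (\<lambda>_. {1..l})"
  have "(\<Sum>x\<in>?\<Omega> I. \<Sum>y\<in>?\<Omega> J. g (merge I J (x, y))) = (\<Sum>(x, y)\<in>?\<Omega> I \<times> ?\<Omega> J. g (merge I J (x, y)))"
    by (rule sum.cartesian_product)
  also have "\<dots> = (\<Sum>z\<in>?\<Omega> (I \<union> J). g z)"
  proof (rule sum.reindex_bij_witness[where i = "\<lambda>z. (restrict z I, restrict z J)" and j = "merge I J"])
    show "merge I J z \<in> ?\<Omega> (I \<union> J)" if "z \<in> ?\<Omega> I \<times> ?\<Omega> J" for z
      using that by (auto simp: merge_def PiE_iff extensional_def)
    show "(restrict (merge I J z) I, restrict (merge I J z) J) = z" if "z \<in> ?\<Omega> I \<times> ?\<Omega> J" for z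
      using that IJ by (cases z) (auto simp: PiE_iff restrict_merge extensional_restrict)
    show "merge I J (restrict z I, restrict z J) = z" if "z \<in> ?\<Omega> (I \<union> J)" for z
      using that by (auto simp: merge_def PiE_iff extensional_def fun_eq_iff)
  qed auto
  finally show ?thesis
    using I J IJ by (simp add: unif_mean_def card_Un_disjoint power_add sum_divide_distrib[symmetric] mult.commute)
qed

text \<open>Almost surely all marks lie in {1..l}, where the integrand is a finite combination of
  indicators of the events \<open>Ev x\<close>; by independence each has probability l^(-card
  I).\<close>

lemma (in prob_space) integral_indep_uniform:
  fixes X :: "'i \<Rightarrow> 'a \<Rightarrow> nat" and g :: "('i \<Rightarrow> nat) \<Rightarrow> complex"
  assumes I: "finite I" "I \<noteq> {}" and l: "l > 0"
    and indep: "indep_vars (\<lambda>_. count_space UNIV) X I"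
    and unif: "\<And>i. i \<in> I \<Longrightarrow> distr M (count_space UNIV) (X i) = measure_pmf (pmf_of_set {1..l})"
  shows "(CLINT \<omega>|M. g (restrict (\<lambda>i. X i \<omega>) I)) = unif_mean l I g"
proof -
  let ?\<Omega> = "PiE I (\<lambda>_. {1..l})"
  define Ev where "Ev = (\<lambda>x. \<Inter>i\<in>I. X i -` {x i} \<inter> space M)"
  have meas: "X i \<in> M \<rightarrow>\<^sub>M count_space UNIV" if "i \<in> I" for i
    using indep that unfolding indep_vars_def by auto
  have fin: "finite ?\<Omega>" using I by (intro finite_PiE) auto
  have Ev_sets: "Ev x \<in> events" for x
    unfolding Ev_def using I meas by (intro sets.finite_INT) (auto intro: measurable_sets)
  have prob_Ev: "prob (Ev x) = 1 / real l ^ card I" if x: "x \<in> ?\<Omega>" for x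
  proof -
    have "prob (Ev x) = (\<Prod>i\<in>I. prob (X i -` {x i} \<inter> space M))"
      unfolding Ev_def using I by (intro indep_varsD[OF indep]) auto
    also have "\<dots> = (\<Prod>i\<in>I. 1 / real l)"
    proof (rule prod.cong[OF refl])
      fix i assume i: "i \<in> I"
      have "prob (X i -` {x i} \<inter> space M) = measure (distr M (count_space UNIV) (X i)) {x i}"
        using meas[OF i] by (subst measure_distr) auto
      also have "\<dots> = 1 / real l"
        unfolding unif[OF i] using PiE_mem[OF x i] l by (simp add: measure_pmf_single pmf_of_set)
      finally show "prob (X i -` {x i} \<inter> space M) = 1 / real l" .
    qed
    finally show ?thesis by (simp add: power_one_over)
  qed
  have AE_range: "AE \<omega> in M. \<forall>i\<in>I. X i \<omega> \<in> {1..l}"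
  proof (rule AE_finite_allI[OF I(1)])
    fix i assume i: "i \<in> I"
    have "AE n in distr M (count_space UNIV) (X i). n \<in> {1..l}"
      unfolding unif[OF i] using l by (intro AE_pmfI) (auto simp: set_pmf_of_set)
    then show "AE \<omega> in M. X i \<omega> \<in> {1..l}"
      using meas[OF i] by (subst (asm) AE_distr_iff) auto
  qed
  have eq: "g (restrict (\<lambda>i. X i \<omega>) I) = (\<Sum>x\<in>?\<Omega>. indicator (Ev x) \<omega> *\<^sub>R g x)"
    if \<omega>: "\<omega> \<in> space M" "\<forall>i\<in>I. X i \<omega> \<in> {1..l}" for \<omega>
  proof -
    define z where "z = restrict (\<lambda>i. X i \<omega>) I"
    have z: "z \<in> ?\<Omega>" using \<omega> by (auto simp: z_def)
    have "indicator (Ev x) \<omega> = (if x = z then 1 else 0 :: real)" if "x \<in> ?\<Omega>" for x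
      using that \<omega> I by (auto simp: Ev_def z_def indicator_def PiE_iff extensional_def fun_eq_iff)
    then have "(\<Sum>x\<in>?\<Omega>. indicator (Ev x) \<omega> *\<^sub>R g x) = (\<Sum>x\<in>?\<Omega>. if x = z then g x else 0)"
      by (intro sum.cong) auto
    also have "\<dots> = g z" using z fin by simp
    finally show ?thesis unfolding z_def ..
  qed
  have "(CLINT \<omega>|M. g (restrict (\<lambda>i. X i \<omega>) I)) = (CLINT \<omega>|M. (\<Sum>x\<in>?\<Omega>. indicator (Ev x) \<omega> *\<^sub>R g x))"
  proof (rule integral_cong_AE)
    have "(\<lambda>\<omega>. restrict (\<lambda>i. X i \<omega>) I) \<in> M \<rightarrow>\<^sub>M PiM I (\<lambda>_. count_space UNIV)"
      using meas by (intro measurable_restrict)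
    \<comment> \<open>A finite product of countable discrete spaces is discrete, so an arbitrary
      \<open>g\<close> is measurable.\<close>
    moreover have "PiM I (\<lambda>_. count_space (UNIV :: nat set)) = count_space (PiE I (\<lambda>_. UNIV))"
      by (rule count_space_PiM_finite) (simp_all add: I)
    ultimately have "(\<lambda>\<omega>. restrict (\<lambda>i. X i \<omega>) I) \<in> M \<rightarrow>\<^sub>M count_space (PiE I (\<lambda>_. UNIV))"
      by simp
    then show "(\<lambda>\<omega>. g (restrict (\<lambda>i. X i \<omega>) I)) \<in> borel_measurable M"
      by (rule measurable_compose) simp
    show "AE \<omega> in M. g (restrict (\<lambda>i. X i \<omega>) I) = (\<Sum>x\<in>?\<Omega>. indicator (Ev x) \<omega> *\<^sub>R g x)"
      using AE_range AE_space by eventually_elim (use eq in auto)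
  qed (use Ev_sets in auto)
  also have "\<dots> = (\<Sum>x\<in>?\<Omega>. prob (Ev x) *\<^sub>R g x)"
    using Ev_sets by (subst Bochner_Integration.integral_sum) (auto simp: less_top[symmetric])
  also have "\<dots> = (\<Sum>x\<in>?\<Omega>. g x / of_nat l ^ card I)"
    by (intro sum.cong) (auto simp: prob_Ev scaleR_conv_of_real)
  finally show ?thesis by (simp add: unif_mean_def sum_divide_distrib)
qed

text \<open>Grouping the edges by their endpoint \<open>j\<close> in the second class, the mean m /
  l of each group is absorbed into \<open>dev\<close>; since n = m^2, the factor sqrt n is
  \<open>m\<close>. The marks are fixed here, hence constant in the sample point.\<close>

lemma xi_merge:
  shows "xi l m (\<lambda>i _. merge {1..m} {m+1..2*m} (x, y) i) \<omega>
    = (\<Sum>j\<in>{m+1..2*m}. dev l {1..m} x (y j)) / (real m * sqrt (1 / real l * (1 - 1 / real l)))"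
proof -
  have "Xi m (\<lambda>i _. merge {1..m} {m+1..2*m} (x, y) i) \<omega> = (\<Sum>i\<in>{1..m}. \<Sum>j\<in>{m+1..2*m}. of_bool (x i = y j))"
    unfolding Xi_def Kmm_edges_def D_def sum.cartesian_product
    by (intro sum.cong) (auto simp: merge_def)
  also have "\<dots> = (\<Sum>j\<in>{m+1..2*m}. \<Sum>i\<in>{1..m}. of_bool (x i = y j))"
    by (rule sum.swap)
  finally have "Xi m (\<lambda>i _. merge {1..m} {m+1..2*m} (x, y) i) \<omega> - real (m\<^sup>2) * (1 / real l)
      = (\<Sum>j\<in>{m+1..2*m}. dev l {1..m} x (y j))"
    by (simp add: dev_def sum_subtractf power2_eq_square)
  moreover have "sqrt (real (m\<^sup>2) * (1 / real l) * (1 - 1 / real l)) = real m * sqrt (1 / real l * (1 - 1 / real l))"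
    unfolding mult.assoc of_nat_power real_sqrt_mult[of "(real m)\<^sup>2"] by simp
  ultimately show ?thesis unfolding xi_def Let_def card_Kmm_edges by simp
qed

lemma borel_measurable_xi:
  assumes M: "\<And>i. i \<in> {1..2*m} \<Longrightarrow> M i \<in> N \<rightarrow>\<^sub>M count_space UNIV"
  shows "xi l m M \<in> borel_measurable N"
proof -
  have "(\<lambda>\<omega>. D M i j \<omega>) \<in> borel_measurable N" if "(i, j) \<in> Kmm_edges m" for i j
  proof -
    have [measurable]: "M i \<in> N \<rightarrow>\<^sub>M count_space UNIV" "M j \<in> N \<rightarrow>\<^sub>M count_space UNIV"
      using that by (auto simp: Kmm_edges_def intro!: M)
    have "D M i j = (\<lambda>\<omega>. if real (M i \<omega>) = real (M j \<omega>) then 1 else 0)"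
      by (simp add: D_def fun_eq_iff)
    also have "\<dots> \<in> borel_measurable N" by measurable
    finally show ?thesis .
  qed
  then show ?thesis
    unfolding xi_def Xi_def Let_def by (auto intro!: borel_measurable_divide borel_measurable_diff borel_measurable_sum)
qed

text \<open>Given the marks of the first class, the statistic is a sum over the second class of a
  function of one mark each, so the inner average factorises. The parameter \<open>s\<close> absorbs
  the standard deviation of a single edge indicator.\<close>

lemma char_xi:
  fixes t :: real
  assumes l: "l \<ge> 2" and m: "m \<ge> 1" and "prob_space P"
    and indep: "prob_space.indep_vars P (\<lambda>_. count_space UNIV) M {1..2*m}"
    and unif: "\<And>i. i \<in> {1..2*m} \<Longrightarrow> distr P (count_space UNIV) (M i) = measure_pmf (pmf_of_set {1..l})"
  defines "s \<equiv> t / sqrt (1 / real l * (1 - 1 / real l))"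
  shows "char (distr P borel (xi l m M)) t
    = unif_mean l {1..m} (\<lambda>x. ((\<Sum>k\<in>{1..l}. iexp (s * dev l {1..m} x k / sqrt m / sqrt m)) / l) ^ m)"
proof -
  interpret prob_space P by fact
  let ?I = "{1..m}" and ?J = "{m+1..2*m}"
  have IJ: "?I \<union> ?J = {1..2*m}" by auto
  have meas: "M i \<in> P \<rightarrow>\<^sub>M count_space UNIV" if "i \<in> {1..2*m}" for i
    using indep that unfolding indep_vars_def by auto
  define g where "g = (\<lambda>z. iexp (t * xi l m (\<lambda>i _. z i) ()))"
  have "char (distr P borel (xi l m M)) t = (CLINT \<omega>|P. iexp (t * xi l m M \<omega>))"
    unfolding char_def using borel_measurable_xi[OF meas] by (subst integral_distr) auto
  also have "\<dots> = (CLINT \<omega>|P. g (restrict (\<lambda>i. M i \<omega>) {1..2*m}))"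
  proof (intro Bochner_Integration.integral_cong refl)
    fix \<omega>
    have "Xi m M \<omega> = Xi m (\<lambda>i _. restrict (\<lambda>i. M i \<omega>) {1..2*m} i) ()"
      unfolding Xi_def D_def by (intro sum.cong) (auto simp: Kmm_edges_def)
    then show "iexp (t * xi l m M \<omega>) = g (restrict (\<lambda>i. M i \<omega>) {1..2*m})"
      unfolding g_def xi_def by simp
  qed
  also have "\<dots> = unif_mean l {1..2*m} g"
    by (rule integral_indep_uniform) (use m l indep unif in auto)
  also have "\<dots> = unif_mean l ?I (\<lambda>x. unif_mean l ?J (\<lambda>y. g (merge ?I ?J (x, y))))"
    unfolding IJ[symmetric] by (rule unif_mean_merge) auto
  also have "\<dots> = unif_mean l ?I (\<lambda>x. unif_mean l ?J (\<lambda>y. \<Prod>j\<in>?J. iexp (s * dev l ?I x (y j) / sqrt m / sqrt m)))"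
  proof -
    have "g (merge ?I ?J (x, y)) = (\<Prod>j\<in>?J. iexp (s * dev l ?I x (y j) / sqrt m / sqrt m))" for x y
    proof -
      have "t * xi l m (\<lambda>i _. merge ?I ?J (x, y) i) () = (\<Sum>j\<in>?J. s * dev l ?I x (y j) / sqrt m / sqrt m)"
        unfolding xi_merge divide_divide_eq_left[of _ "sqrt m"]
        by (simp add: s_def sum_distrib_left sum_divide_distrib mult_ac)
      then show ?thesis
        unfolding g_def by (simp only: of_real_sum sum_distrib_left exp_sum finite_atLeastAtMost)
    qed
    then show ?thesis by simp
  qed
  also have "\<dots> = unif_mean l ?I (\<lambda>x. ((\<Sum>k\<in>{1..l}. iexp (s * dev l ?I x k / sqrt m / sqrt m)) / l) ^ m)"
    by (subst unif_mean_prod) simp_all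
  finally show ?thesis .
qed

section \<open>Weak convergence by Levy's continuity theorem\<close>

lemma real_distribution_distr:
  assumes "prob_space P" "X \<in> borel_measurable P"
  shows "real_distribution (distr P borel X)"
  using prob_space.prob_space_distr[OF assms]
  by (simp add: real_distribution_def real_distribution_axioms_def)

theorem theorem4p1:
  fixes l :: nat
    and P :: "nat \<Rightarrow> 'a measure"
    and M :: "nat \<Rightarrow> nat \<Rightarrow> 'a \<Rightarrow> nat"
  assumes "l \<ge> 2"
    and "\<And>m. m \<ge> 1 \<Longrightarrow> prob_space (P m)"
    and "\<And>m. m \<ge> 1 \<Longrightarrow>
           prob_space.indep_vars (P m) (\<lambda>_. count_space UNIV) (M m) {1..2*m}"
    and "\<And>m i. m \<ge> 1 \<Longrightarrow> i \<in> {1..2*m} \<Longrightarrow>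
           distr (P m) (count_space UNIV) (M m i) = measure_pmf (pmf_of_set {1..l})"
  shows "weak_conv_m
           (\<lambda>m. distr (P m) borel (xi l m (M m)))
           (distr (VG (real l - 1)) borel (\<lambda>x. x / sqrt (real l - 1)))"
proof -
  let ?S = "\<lambda>m. distr (P m) borel (xi l m (M m))"
  let ?V = "distr (VG (real l - 1)) borel (\<lambda>x. x / sqrt (real l - 1))"
  have a: "real l - 1 > 0" using assms(1) by simp
  interpret VG: real_distribution "VG (real l - 1)" by (rule real_distribution_VG[OF a])
  \<comment> \<open>The assumptions say nothing about the index 0, whose law need not be a
    probability measure, so the continuity theorem is applied to the shifted sequence.\<close>
  have "weak_conv_m (\<lambda>m. ?S (Suc m)) ?V"
  proof (rule levy_continuity)
    show "real_distribution (?S (Suc m))" for m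
    proof (rule real_distribution_distr)
      show P: "prob_space (P (Suc m))" by (rule assms(2)) simp
      show "xi l (Suc m) (M (Suc m)) \<in> borel_measurable (P (Suc m))"
        using assms(3)[of "Suc m"] unfolding prob_space.indep_vars_def[OF P]
        by (intro borel_measurable_xi) auto
    qed
    show "real_distribution ?V"
      by (intro real_distribution_distr VG.prob_space_axioms) simp
    fix t :: real
    define s where "s = t / sqrt (1 / real l * (1 - 1 / real l))"
    define \<phi> where "\<phi> = (\<lambda>m::nat. unif_mean l ({1..m} :: nat set)
      (\<lambda>x. ((\<Sum>k\<in>{1..l}. iexp (s * dev l {1..m} x k / sqrt m / sqrt m)) / l) ^ m))"
    have "char (?S (Suc m)) t = \<phi> (Suc m)" for m
      unfolding \<phi>_def s_def by (intro char_xi assms) simp_all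
    moreover have "char ?V t = complex_of_real ((1 + s\<^sup>2 / (real l)\<^sup>2) powr (- (real l - 1) / 2))"
    proof -
      have "0 \<le> 1 / real l * (1 - 1 / real l)" using assms(1) by simp
      then have "s\<^sup>2 / (real l)\<^sup>2 = t\<^sup>2 / (1 / real l * (1 - 1 / real l) * (real l)\<^sup>2)"
        by (simp add: s_def power_divide)
      also have "1 / real l * (1 - 1 / real l) * (real l)\<^sup>2 = real l - 1"
        using assms(1) by (simp add: power2_eq_square field_simps)
      \<comment> \<open>This matches the limit parameter with \<open>char_VG\<close> at t / sqrt (l
        - 1), the source of the scaling of the limit variable.\<close>
      finally have s2: "s\<^sup>2 / (real l)\<^sup>2 = (t / sqrt (real l - 1))\<^sup>2"
        using a by (simp add: power_divide)
      have "char ?V t = char (VG (real l - 1)) (t / sqrt (real l - 1))"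
        unfolding char_def by (subst integral_distr) auto
      then show ?thesis unfolding s2 char_VG[OF a] by simp
    qed
    moreover have "(\<lambda>m. \<phi> (Suc m)) \<longlonglongrightarrow> complex_of_real ((1 + s\<^sup>2 / (real l)\<^sup>2) powr (- (real l - 1) / 2))"
      unfolding \<phi>_def using unif_mean_char_tendsto[of l s, THEN LIMSEQ_Suc] assms(1) by simp
    ultimately show "(\<lambda>m. char (?S (Suc m)) t) \<longlonglongrightarrow> char ?V t" by simp
  qed
  \<comment> \<open>Limits of the distribution functions are insensitive to the shift, so the index
    0 can be restored.\<close>
  then have "(\<lambda>m. cdf (?S (Suc m)) x) \<longlonglongrightarrow> cdf ?V x" if "isCont (cdf ?V) x" for x
    using that unfolding weak_conv_m_def weak_conv_def by blast
  then have "(\<lambda>m. cdf (?S m) x) \<longlonglongrightarrow> cdf ?V x" if "isCont (cdf ?V) x" for x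
    using that by (intro LIMSEQ_imp_Suc[of "\<lambda>m. cdf (?S m) x"])
  then show ?thesis unfolding weak_conv_m_def weak_conv_def by blast
qed

end
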